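(* Let $S$ and $T$ be non-isomorphic finite trees, each with at least $3$ vertices. Then $\delta(S,T) > 0$, where $\delta(S,T) = \lim_{n\to\infty} \mathrm{TV}\left(\mathrm{UA}(n,S), \mathrm{UA}(n,T)\right)$.
   Context: Uniform attachment: for $n \ge k \ge 2$ and a tree $S$ on $k$ vertices (the seed), the random tree $\mathrm{UA}(n,S)$ is defined inductively by $\mathrm{UA}(k,S)=S$ and, given $\mathrm{UA}(n,S)$, the tree $\mathrm{UA}(n+1,S)$ is formed by adding a new vertex $u$ and a new edge $uv$, where $v$ is chosen uniformly at random among the vertices of $\mathrm{UA}(n,S)$, independently of all past choices. The trees are observed as unlabeled, unrooted trees: $\mathrm{UA}(n,S)$ is viewed as a random variable with values in the finite set of isomorphism classes of trees on $n$ vertices. For random variables $X,Y$ with values in a finite set $\mathcal{X}$ and laws $\mu,\nu$, $\mathrm{TV}(X,Y) = \frac12 \sum_{x\in\mathcal{X}} |\mu(x)-\nu(x)|$. The quantity $\mathrm{TV}(\mathrm{UA}(n,S),\mathrm{UA}(n,T))$ is defined for $n \ge \max\{|S|,|T|\}$ and is non-increasing in $n$, so the limit defining $\delta(S,T)$ exists. *)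

theory Defs
  imports "HOL-Probability.Probability"
begin

text \<open>
  Finite simple graphs with vertices taken from \<^typ>\<open>nat\<close>; every finite graph has an isomorphic
  copy of this kind. Edges are two-element vertex sets.
\<close>

datatype ugraph = Graph (verts: "nat set") (edges: "nat set set")

definition simple_graph :: "ugraph \<Rightarrow> bool" where
  "simple_graph G \<longleftrightarrow> finite (verts G) \<and> (\<forall>e\<in>edges G. e \<subseteq> verts G \<and> card e = 2)"

definition connected_graph :: "ugraph \<Rightarrow> bool" where
  "connected_graph G \<longleftrightarrow> verts G \<noteq> {} \<and>
     (\<forall>u\<in>verts G. \<forall>v\<in>verts G. (u, v) \<in> {(x, y). {x, y} \<in> edges G}\<^sup>*)"

definition graph_cycle :: "ugraph \<Rightarrow> nat list \<Rightarrow> bool" where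
  "graph_cycle G c \<longleftrightarrow> length c \<ge> 3 \<and> distinct c \<and>
     (\<forall>i<length c. {c ! i, c ! (Suc i mod length c)} \<in> edges G)"

definition is_tree :: "ugraph \<Rightarrow> bool" where
  "is_tree G \<longleftrightarrow> simple_graph G \<and> connected_graph G \<and> (\<nexists>c. graph_cycle G c)"

definition graph_iso :: "ugraph \<Rightarrow> ugraph \<Rightarrow> bool" where
  "graph_iso G H \<longleftrightarrow> (\<exists>f. bij_betw f (verts G) (verts H) \<and>
     (\<forall>u\<in>verts G. \<forall>v\<in>verts G. {u, v} \<in> edges G \<longleftrightarrow> {f u, f v} \<in> edges H))"

definition iso_class :: "ugraph \<Rightarrow> ugraph set" where
  "iso_class G = {H. is_tree H \<and> graph_iso G H}"

definition tree_classes :: "nat \<Rightarrow> ugraph set set" where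
  "tree_classes n = iso_class ` {G. is_tree G \<and> card (verts G) = n}"

text \<open>
  The label of the new vertex is the least unused one. This choice is immaterial, since the trees
  are only ever observed up to isomorphism.
\<close>

definition fresh :: "ugraph \<Rightarrow> nat" where
  "fresh G = (LEAST u. u \<notin> verts G)"

definition attach :: "ugraph \<Rightarrow> nat \<Rightarrow> ugraph" where
  "attach G v = Graph (insert (fresh G) (verts G)) (insert {fresh G, v} (edges G))"

definition UA_step :: "ugraph \<Rightarrow> ugraph pmf" where
  "UA_step G = map_pmf (attach G) (pmf_of_set (verts G))"

text \<open>
  The first argument is the number of vertices. Values of it smaller than the size of the seed are
  meaningless and yield the seed itself.
\<close>

primrec UA_labeled :: "nat \<Rightarrow> ugraph \<Rightarrow> ugraph pmf" where
  "UA_labeled 0 S = return_pmf S"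
| "UA_labeled (Suc n) S =
     (if Suc n \<le> card (verts S) then return_pmf S else bind_pmf (UA_labeled n S) UA_step)"

definition UA :: "nat \<Rightarrow> ugraph \<Rightarrow> ugraph set pmf" where
  "UA n S = map_pmf iso_class (UA_labeled n S)"

definition TV :: "'a set \<Rightarrow> 'a pmf \<Rightarrow> 'a pmf \<Rightarrow> real" where
  "TV X \<mu> \<nu> = 1 / 2 * (\<Sum>x\<in>X. \<bar>pmf \<mu> x - pmf \<nu> x\<bar>)"

definition delta :: "ugraph \<Rightarrow> ugraph \<Rightarrow> real" where
  "delta S T = lim (\<lambda>n. TV (tree_classes n) (UA n S) (UA n T))"


text \<open>
  The remainder shows that these definitions make sense: \<^term>\<open>TV\<close> is applied to finite
  sets carrying the laws in question, and the limit in \<^term>\<open>delta\<close> exists.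
\<close>

lemma graph_iso_refl: "graph_iso G G"
  unfolding graph_iso_def by (rule exI[of _ id]) auto

lemma graph_iso_sym:
  assumes "graph_iso G H" shows "graph_iso H G"
proof -
  obtain f where f: "bij_betw f (verts G) (verts H)"
    and e: "\<And>u v. u \<in> verts G \<Longrightarrow> v \<in> verts G \<Longrightarrow> {u, v} \<in> edges G \<longleftrightarrow> {f u, f v} \<in> edges H"
    using assms unfolding graph_iso_def by blast
  let ?g = "inv_into (verts G) f"
  have g: "bij_betw ?g (verts H) (verts G)" using f by (rule bij_betw_inv_into)
  have "{u, v} \<in> edges H \<longleftrightarrow> {?g u, ?g v} \<in> edges G" if "u \<in> verts H" "v \<in> verts H" for u v
    using e[of "?g u" "?g v"] that bij_betwE[OF g] bij_betw_inv_into_right[OF f] by simp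
  with g show ?thesis unfolding graph_iso_def by blast
qed

lemma graph_iso_trans:
  assumes "graph_iso G H" "graph_iso H K" shows "graph_iso G K"
proof -
  obtain f where f: "bij_betw f (verts G) (verts H)"
    and e: "\<And>u v. u \<in> verts G \<Longrightarrow> v \<in> verts G \<Longrightarrow> {u, v} \<in> edges G \<longleftrightarrow> {f u, f v} \<in> edges H"
    using assms(1) unfolding graph_iso_def by blast
  obtain g where g: "bij_betw g (verts H) (verts K)"
    and e': "\<And>u v. u \<in> verts H \<Longrightarrow> v \<in> verts H \<Longrightarrow> {u, v} \<in> edges H \<longleftrightarrow> {g u, g v} \<in> edges K"
    using assms(2) unfolding graph_iso_def by blast
  show ?thesis unfolding graph_iso_def
    using bij_betw_trans[OF f g] e e' bij_betwE[OF f]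
    by (intro exI[of _ "g \<circ> f"]) auto
qed

lemma iso_class_eqI: "graph_iso G H \<Longrightarrow> iso_class G = iso_class H"
  unfolding iso_class_def using graph_iso_sym graph_iso_trans by blast

lemma iso_class_eq_iff:
  assumes "is_tree H" shows "iso_class G = iso_class H \<longleftrightarrow> graph_iso G H"
proof
  assume "iso_class G = iso_class H"
  moreover have "H \<in> iso_class H" using assms graph_iso_refl by (simp add: iso_class_def)
  ultimately show "graph_iso G H" by (auto simp: iso_class_def)
qed (rule iso_class_eqI)

lemma simple_graph_image_iso:
  assumes "simple_graph G" and f: "inj_on f (verts G)"
  shows "graph_iso G (Graph (f ` verts G) ((`) f ` edges G))"
proof -
  have "{u, v} \<in> edges G"
    if uv: "u \<in> verts G" "v \<in> verts G" "{f u, f v} \<in> (`) f ` edges G" for u v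
  proof -
    obtain e where e: "e \<in> edges G" "f ` {u, v} = f ` e" using uv(3) by auto
    then have "e \<subseteq> verts G" using assms(1) by (auto simp: simple_graph_def)
    then have "e = {u, v}" using inj_on_image_eq_iff[OF f, of "{u, v}" e] e(2) uv by auto
    with e show ?thesis by simp
  qed
  moreover have "{f u, f v} \<in> (`) f ` edges G" if "{u, v} \<in> edges G" for u v
    using imageI[OF that, of "(`) f"] by simp
  ultimately show ?thesis
    unfolding graph_iso_def using inj_on_imp_bij_betw[OF f] by (intro exI[of _ f]) auto
qed

lemma finite_tree_classes: "finite (tree_classes n)"
proof -
  let ?B = "(\<lambda>E. Graph {0..<n} E) ` Pow (Pow {0..<n})"
  have "tree_classes n \<subseteq> iso_class ` ?B"
  proof
    fix c assume "c \<in> tree_classes n"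
    then obtain G where G: "is_tree G" "card (verts G) = n" "c = iso_class G"
      by (auto simp: tree_classes_def)
    have s: "simple_graph G" using G(1) by (simp add: is_tree_def)
    then obtain f where f: "bij_betw f (verts G) {0..<n}"
      using ex_bij_betw_finite_nat[of "verts G"] G(2) by (auto simp: simple_graph_def)
    let ?H = "Graph {0..<n} ((`) f ` edges G)"
    have "graph_iso G ?H"
      using simple_graph_image_iso[OF s, of f] f by (simp add: bij_betw_def)
    then have "c = iso_class ?H" using iso_class_eqI G(3) by simp
    moreover have "(`) f ` edges G \<subseteq> Pow {0..<n}"
      using s f by (auto simp: simple_graph_def bij_betw_def)
    ultimately show "c \<in> iso_class ` ?B" by blast
  qed
  then show ?thesis by (rule finite_subset) simp
qed

lemma fresh_notin: "finite (verts G) \<Longrightarrow> fresh G \<notin> verts G"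
  unfolding fresh_def by (rule LeastI_ex) (metis ex_new_if_finite infinite_UNIV_nat)

lemma verts_attach [simp]: "verts (attach G v) = insert (fresh G) (verts G)"
  and edges_attach [simp]: "edges (attach G v) = insert {fresh G, v} (edges G)"
  by (simp_all add: attach_def)

lemma is_tree_attach:
  assumes G: "is_tree G" and v: "v \<in> verts G"
  shows "is_tree (attach G v)"
proof -
  let ?w = "fresh G"
  let ?R = "{(x, y). {x, y} \<in> edges G}" and ?R' = "{(x, y). {x, y} \<in> edges (attach G v)}"
  have s: "simple_graph G" and con: "connected_graph G" and acyc: "\<And>c. \<not> graph_cycle G c"
    using G by (auto simp: is_tree_def)
  have w: "?w \<notin> verts G" using s by (intro fresh_notin) (simp add: simple_graph_def)
  have we: "?w \<notin> e" if "e \<in> edges G" for e using s w that by (auto simp: simple_graph_def)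
  have "simple_graph (attach G v)"
    using s v w by (auto simp: simple_graph_def card_insert_if)
  moreover have "connected_graph (attach G v)"
  proof -
    have "?R \<subseteq> ?R'" by auto
    then have old: "(x, y) \<in> ?R'\<^sup>*" if "x \<in> verts G" "y \<in> verts G" for x y
      using con that rtrancl_mono[of ?R ?R'] unfolding connected_graph_def by blast
    have a: "(?w, v) \<in> ?R'" "(v, ?w) \<in> ?R'" by (auto simp: insert_commute)
    have to_v: "(x, v) \<in> ?R'\<^sup>*" if "x \<in> verts (attach G v)" for x
      using that a old v by auto
    have from_v: "(v, x) \<in> ?R'\<^sup>*" if "x \<in> verts (attach G v)" for x
      using that a old v by auto
    show ?thesis unfolding connected_graph_def
      using to_v from_v rtrancl_trans[of _ v ?R'] by auto
  qed
  moreover have "\<not> graph_cycle (attach G v) c" for c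
  proof
    assume c: "graph_cycle (attach G v) c"
    let ?l = "length c"
    have l: "?l \<ge> 3" and d: "distinct c"
      and ce: "\<And>i. i < ?l \<Longrightarrow> {c ! i, c ! (Suc i mod ?l)} \<in> insert {?w, v} (edges G)"
      using c by (auto simp: graph_cycle_def)
    show False
    proof (cases "?w \<in> set c")
      case False
      have "{c ! i, c ! (Suc i mod ?l)} \<in> edges G" if "i < ?l" for i
      proof -
        have "Suc i mod ?l < ?l" using l by (intro mod_less_divisor) linarith
        then have "c ! i \<noteq> ?w" "c ! (Suc i mod ?l) \<noteq> ?w" using that False nth_mem by metis+
        then show ?thesis using ce[OF that] by (auto simp: doubleton_eq_iff)
      qed
      then have "graph_cycle G c" using l d by (simp add: graph_cycle_def)
      with acyc show False by blast
    next
      case True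
      then obtain i where i: "i < ?l" "c ! i = ?w" by (auto simp: in_set_conv_nth)
      define j where "j = Suc i mod ?l"
      define k where "k = (if i = 0 then ?l - 1 else i - 1)"
      have k: "k < ?l" "Suc k mod ?l = i" using i l by (auto simp: k_def)
      have j: "j < ?l" using l unfolding j_def by (intro mod_less_divisor) linarith
      have "j \<noteq> k"
        using i l by (auto simp: j_def k_def mod_Suc split: if_splits)
      moreover have "c ! j = v"
        using ce[OF i(1)] i(2) we by (fastforce simp: j_def doubleton_eq_iff)
      moreover have "c ! k = v"
        using ce[OF k(1)] k(2) i(2) we by (fastforce simp: doubleton_eq_iff)
      ultimately show False using d j k(1) nth_eq_iff_index_eq[of c j k] by simp
    qed
  qed
  ultimately show ?thesis by (simp add: is_tree_def)
qed

lemma set_pmf_UA_step: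
  assumes "is_tree G"
  shows "set_pmf (UA_step G) = attach G ` verts G"
  using assms
  by (simp add: UA_step_def is_tree_def simple_graph_def connected_graph_def)

lemma UA_labeled_seed: "UA_labeled (card (verts S)) S = return_pmf S"
  by (cases "card (verts S)") simp_all

lemma UA_labeled_tree:
  assumes S: "is_tree S" and n: "card (verts S) \<le> n" and G: "G \<in> set_pmf (UA_labeled n S)"
  shows "is_tree G \<and> card (verts G) = n"
  using n G
proof (induction n arbitrary: G rule: dec_induct)
  case base
  then show ?case using S by (simp add: UA_labeled_seed)
next
  case (step n)
  then obtain H where H: "H \<in> set_pmf (UA_labeled n S)" "G \<in> set_pmf (UA_step H)" by auto
  from step.IH[OF H(1)] have t: "is_tree H" "card (verts H) = n" by auto
  then obtain v where v: "v \<in> verts H" "G = attach H v" using H(2) set_pmf_UA_step[of H] by auto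
  have "finite (verts H)" using t(1) by (simp add: is_tree_def simple_graph_def)
  then show ?case using t v is_tree_attach[of H v] fresh_notin[of H] by simp
qed

lemma set_pmf_UA:
  assumes "is_tree S" "card (verts S) \<le> n"
  shows "set_pmf (UA n S) \<subseteq> tree_classes n"
proof -
  have "set_pmf (UA_labeled n S) \<subseteq> {G. is_tree G \<and> card (verts G) = n}"
    using UA_labeled_tree[OF assms] by blast
  then show ?thesis unfolding UA_def tree_classes_def set_map_pmf by (rule image_mono)
qed

lemma graph_iso_attach:
  assumes f: "bij_betw f (verts G) (verts H)"
    and e: "\<And>u v. u \<in> verts G \<Longrightarrow> v \<in> verts G \<Longrightarrow> {u, v} \<in> edges G \<longleftrightarrow> {f u, f v} \<in> edges H"
    and GH: "simple_graph G" "simple_graph H" and v: "v \<in> verts G"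
  shows "graph_iso (attach G v) (attach H (f v))"
proof -
  let ?w = "fresh G" and ?w' = "fresh H"
  define g where "g = f(?w := ?w')"
  have w: "?w \<notin> verts G" "?w' \<notin> verts H"
    using GH by (auto simp: simple_graph_def dest: fresh_notin)
  have nw: "\<And>x. {?w, x} \<notin> edges G" "\<And>x. {x, ?w} \<notin> edges G"
    "\<And>x. {?w', x} \<notin> edges H" "\<And>x. {x, ?w'} \<notin> edges H"
    using GH w by (auto simp: simple_graph_def)
  have gf: "g x = f x" if "x \<in> verts G" for x using that w by (auto simp: g_def)
  have gw: "g ?w = ?w'" by (simp add: g_def)
  have "bij_betw g (verts G) (verts H)" using f gf bij_betw_cong by metis
  then have "bij_betw g (verts G \<union> {?w}) (verts H \<union> {?w'})"
    using w by (intro bij_betw_combine) (auto simp: gw)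
  then have "bij_betw g (verts (attach G v)) (verts (attach H (f v)))" by simp
  moreover have "{x, y} \<in> edges (attach G v) \<longleftrightarrow> {g x, g y} \<in> edges (attach H (f v))"
    if xy: "x \<in> verts (attach G v)" "y \<in> verts (attach G v)" for x y
  proof -
    have inj: "f a = f b \<longleftrightarrow> a = b" if "a \<in> verts G" "b \<in> verts G" for a b
      using f that by (auto simp: bij_betw_def inj_on_def)
    have im: "f a \<in> verts H" if "a \<in> verts G" for a using bij_betwE[OF f] that by blast
    have nv: "v \<noteq> ?w" "f v \<noteq> ?w'" using v w im[OF v] by auto
    consider "x = ?w" "y = ?w" | "x = ?w" "y \<in> verts G" | "x \<in> verts G" "y = ?w"
      | "x \<in> verts G" "y \<in> verts G" using xy unfolding verts_attach by blast
    then show ?thesis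
    proof cases
      case 1 then show ?thesis using nw[of ?w] nw[of ?w'] nv by (auto simp: gw doubleton_eq_iff)
    next
      case 2
      then show ?thesis using nw nv inj[of y v] v by (auto simp: gw gf doubleton_eq_iff)
    next
      case 3
      then show ?thesis using nw nv inj[of x v] v by (auto simp: gw gf doubleton_eq_iff)
    next
      case 4
      then have "x \<noteq> ?w" "y \<noteq> ?w" "f x \<noteq> ?w'" "f y \<noteq> ?w'" using w im[OF 4(1)] im[OF 4(2)] 4 by auto
      then show ?thesis using e[OF 4] 4 by (auto simp: gf doubleton_eq_iff)
    qed
  qed
  ultimately show ?thesis unfolding graph_iso_def by blast
qed

lemma UA_step_iso:
  assumes "graph_iso G H" "is_tree G" "is_tree H"
  shows "map_pmf iso_class (UA_step G) = map_pmf iso_class (UA_step H)"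
proof -
  obtain f where f: "bij_betw f (verts G) (verts H)"
    and e: "\<And>u v. u \<in> verts G \<Longrightarrow> v \<in> verts G \<Longrightarrow> {u, v} \<in> edges G \<longleftrightarrow> {f u, f v} \<in> edges H"
    using assms(1) unfolding graph_iso_def by blast
  have G: "simple_graph G" "simple_graph H" "verts G \<noteq> {}" "finite (verts G)"
    using assms by (auto simp: is_tree_def connected_graph_def simple_graph_def)
  have "pmf_of_set (verts H) = map_pmf f (pmf_of_set (verts G))"
    using map_pmf_of_set_inj[of f "verts G"] f G by (simp add: bij_betw_def)
  then have "map_pmf iso_class (UA_step H) =
      map_pmf (\<lambda>v. iso_class (attach H (f v))) (pmf_of_set (verts G))"
    by (simp add: UA_step_def pmf.map_comp o_def)
  also have "\<dots> = map_pmf (\<lambda>v. iso_class (attach G v)) (pmf_of_set (verts G))"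
  proof (intro map_pmf_cong refl)
    fix v assume "v \<in> set_pmf (pmf_of_set (verts G))"
    then have "v \<in> verts G" using G by simp
    then have "graph_iso (attach G v) (attach H (f v))"
      by (intro graph_iso_attach f e G)
    then show "iso_class (attach H (f v)) = iso_class (attach G v)"
      by (simp add: iso_class_eqI)
  qed
  also have "\<dots> = map_pmf iso_class (UA_step G)"
    by (simp add: UA_step_def pmf.map_comp o_def)
  finally show ?thesis by simp
qed

definition UA_kernel :: "ugraph set \<Rightarrow> ugraph set pmf" where
  "UA_kernel c = map_pmf iso_class (UA_step (SOME G. G \<in> c))"

lemma UA_Suc:
  assumes S: "is_tree S" and n: "card (verts S) \<le> n"
  shows "UA (Suc n) S = bind_pmf (UA n S) UA_kernel"
proof -
  have k: "UA_kernel (iso_class G) = map_pmf iso_class (UA_step G)"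
    if "G \<in> set_pmf (UA_labeled n S)" for G
  proof -
    have t: "is_tree G" using UA_labeled_tree[OF S n that] by simp
    have "(SOME H. H \<in> iso_class G) \<in> iso_class G"
      by (rule someI[of _ G]) (simp add: iso_class_def t graph_iso_refl)
    then have "is_tree (SOME H. H \<in> iso_class G)" "graph_iso (SOME H. H \<in> iso_class G) G"
      by (simp_all add: iso_class_def graph_iso_sym)
    then show ?thesis
      unfolding UA_kernel_def using t by (intro UA_step_iso)
  qed
  have "UA (Suc n) S = bind_pmf (UA_labeled n S) (\<lambda>G. map_pmf iso_class (UA_step G))"
    using n by (simp add: UA_def map_bind_pmf)
  also have "\<dots> = bind_pmf (UA_labeled n S) (\<lambda>G. UA_kernel (iso_class G))"
    using k by (intro bind_pmf_cong) simp_all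
  also have "\<dots> = bind_pmf (UA n S) UA_kernel" by (simp add: UA_def bind_map_pmf)
  finally show ?thesis .
qed

lemma pmf_bind_finite:
  assumes "finite X" "set_pmf p \<subseteq> X"
  shows "pmf (bind_pmf p K) y = (\<Sum>x\<in>X. pmf p x * pmf (K x) y)"
  unfolding pmf_bind using integral_measure_pmf[OF assms(1), of p "\<lambda>x. pmf (K x) y"] assms(2)
  by auto

lemma TV_bind_le:
  assumes "finite X" "finite Y" "set_pmf p \<subseteq> X" "set_pmf q \<subseteq> X"
  shows "TV Y (bind_pmf p K) (bind_pmf q K) \<le> TV X p q"
proof -
  have "(\<Sum>y\<in>Y. \<bar>pmf (bind_pmf p K) y - pmf (bind_pmf q K) y\<bar>) =
      (\<Sum>y\<in>Y. \<bar>\<Sum>x\<in>X. (pmf p x - pmf q x) * pmf (K x) y\<bar>)"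
    by (simp add: pmf_bind_finite[OF assms(1,3)] pmf_bind_finite[OF assms(1,4)]
        sum_subtractf left_diff_distrib)
  also have "\<dots> \<le> (\<Sum>y\<in>Y. \<Sum>x\<in>X. \<bar>(pmf p x - pmf q x) * pmf (K x) y\<bar>)"
    by (intro sum_mono sum_abs)
  also have "\<dots> = (\<Sum>x\<in>X. \<bar>pmf p x - pmf q x\<bar> * (\<Sum>y\<in>Y. pmf (K x) y))"
    by (subst sum.swap) (simp add: abs_mult sum_distrib_left)
  also have "\<dots> \<le> (\<Sum>x\<in>X. \<bar>pmf p x - pmf q x\<bar>)"
  proof (rule sum_mono)
    fix x
    have "(\<Sum>y\<in>Y. pmf (K x) y) \<le> 1"
      using measure_measure_pmf_finite[OF assms(2), of "K x"] measure_pmf.prob_le_1[of "K x" Y]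
      by simp
    then show "\<bar>pmf p x - pmf q x\<bar> * (\<Sum>y\<in>Y. pmf (K x) y) \<le> \<bar>pmf p x - pmf q x\<bar>"
      by (intro mult_left_le) auto
  qed
  finally show ?thesis by (simp add: TV_def)
qed

lemma TV_UA_decreasing:
  assumes "is_tree S" "is_tree T" "card (verts S) \<le> n" "card (verts T) \<le> n"
  shows "TV (tree_classes (Suc n)) (UA (Suc n) S) (UA (Suc n) T)
    \<le> TV (tree_classes n) (UA n S) (UA n T)"
proof -
  have eq: "UA (Suc n) S = bind_pmf (UA n S) UA_kernel"
    "UA (Suc n) T = bind_pmf (UA n T) UA_kernel"
    using UA_Suc assms by blast+
  show ?thesis
    unfolding eq
    by (rule TV_bind_le[OF finite_tree_classes finite_tree_classes])
      (rule set_pmf_UA, rule assms, rule assms)+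
qed

lemma delta_LIMSEQ:
  assumes "is_tree S" "is_tree T"
  shows "(\<lambda>n. TV (tree_classes n) (UA n S) (UA n T)) \<longlonglongrightarrow> delta S T"
proof -
  define t where "t n = TV (tree_classes n) (UA n S) (UA n T)" for n
  define m where "m = max (card (verts S)) (card (verts T))"
  have le: "card (verts S) \<le> m" "card (verts T) \<le> m" by (simp_all add: m_def)
  have "t (Suc n + m) \<le> t (n + m)" for n
    using TV_UA_decreasing[OF assms, of "n + m"] le by (simp only: t_def add_Suc trans_le_add2)
  then have "decseq (\<lambda>n. t (n + m))" by (rule decseq_SucI)
  moreover have "0 \<le> t n" for n by (simp add: t_def TV_def sum_nonneg)
  ultimately have "convergent (\<lambda>n. t (n + m))"
    using decseq_convergent[of "\<lambda>n. t (n + m)" 0] unfolding convergent_def by blast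
  then have "convergent t" using convergent_ignore_initial_segment by blast
  then have "t \<longlonglongrightarrow> lim t" by (simp add: convergent_LIMSEQ_iff)
  then show ?thesis unfolding delta_def t_def .
qed

end

theory Submission
  imports Defs
begin

text \<open>
  For a connected pattern \<open>P\<close> on \<open>m\<close> vertices let \<open>F P G\<close> be the sum, over all embeddings of \<open>P\<close>
  in \<open>G\<close>, of \<open>\<Prod>u. c u * (c u + 1)\<close>, where \<open>c u\<close> is the number of vertices of \<open>G\<close> whose nearest
  point in the copy of \<open>P\<close> is the image of \<open>u\<close>. Rising factorials turn the growth of these numbers
  (a Polya urn) into an exact linear recursion: one attachment to a graph with \<open>n\<close> vertices
  multiplies the expectation of \<open>F P\<close> by \<open>1 + 2 * m / n\<close> and adds \<open>2 / n\<close> times the values of \<open>F\<close>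
  at the patterns \<open>P\<close> minus a leaf. Among trees with \<open>m\<close> vertices \<open>F P\<close> is nonzero only on the copies
  of \<open>P\<close>, so at size \<open>max |S| |T|\<close> some \<open>P\<close> has different expectations for the two seeds. For
  the smallest such \<open>P\<close> the lower-order terms cancel in the difference, which therefore grows
  exactly like \<open>n ^ (2 * m)\<close>.

  It remains to bound the second moment of \<open>F P\<close> by a multiple of \<open>n ^ (4 * m)\<close>. With a root \<open>r\<close> and
  \<open>Q\<close> the sum over pairs \<open>x, y\<close> of the number of common ancestors, \<open>F P G\<close> is at most a
  constant times \<open>n\<^sup>2 * Q ^ (m - 1)\<close>, and by Jensen's inequality all moments of \<open>Q / n\<^sup>2\<close> are controlled
  by the mean over pairs of \<open>(3 / 2)\<close> to the number of common ancestors, whose expectation again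
  obeys a linear recursion.
\<close>

section \<open>Pattern counts\<close>

definition adj :: "ugraph \<Rightarrow> (nat \<times> nat) set" where
  "adj G = {(x, y). {x, y} \<in> edges G}"

definition neighbours :: "ugraph \<Rightarrow> nat \<Rightarrow> nat set" where
  "neighbours G x = {y. {x, y} \<in> edges G}"

definition delete :: "nat \<Rightarrow> ugraph \<Rightarrow> ugraph" where
  "delete u G = Graph (verts G - {u}) {e \<in> edges G. u \<notin> e}"

lemma verts_delete [simp]: "verts (delete u G) = verts G - {u}"
  and edges_delete [simp]: "edges (delete u G) = {e \<in> edges G. u \<notin> e}"
  by (simp_all add: delete_def)

lemma simple_graph_edgeD:
  assumes "simple_graph G" "{x, y} \<in> edges G"
  shows "x \<in> verts G" "y \<in> verts G" "x \<noteq> y"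
  using assms by (auto simp: simple_graph_def)

lemma simple_graph_delete: "simple_graph G \<Longrightarrow> simple_graph (delete u G)"
  by (auto simp: simple_graph_def)

lemma connected_graph_induct [consumes 3, case_names base step]:
  assumes "connected_graph G" "x \<in> verts G" "y \<in> verts G"
    and "P x" and "\<And>a b. {a, b} \<in> edges G \<Longrightarrow> P a \<Longrightarrow> P b"
  shows "P y"
proof -
  have "(x, y) \<in> {(x, y). {x, y} \<in> edges G}\<^sup>*"
    using assms by (auto simp: connected_graph_def)
  then show ?thesis
    by (induction rule: rtrancl_induct) (use assms in auto)
qed

lemma connected_graph_delete_leaf:
  assumes s: "simple_graph G" and c: "connected_graph G" and u: "neighbours G u = {p}"
  shows "connected_graph (delete u G)"
proof -
  have up: "{u, p} \<in> edges G" using u by (auto simp: neighbours_def)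
  have p: "p \<in> verts G" "p \<noteq> u" using simple_graph_edgeD[OF s up] by auto
  have nb: "b = p" if "{u, b} \<in> edges G" for b using u that by (auto simp: neighbours_def)
  have "(x, y) \<in> (adj (delete u G))\<^sup>*" if "x \<in> verts G - {u}" "y \<in> verts G - {u}" for x y
  proof -
    \<comment> \<open>A walk enters and leaves the leaf \<open>u\<close> through \<open>p\<close>
      only, so reading \<open>u\<close> as \<open>p\<close> turns it into a walk that avoids
      \<open>u\<close>.\<close>
    have "(x, if y = u then p else y) \<in> (adj (delete u G))\<^sup>*"
    proof (rule connected_graph_induct[OF c, of x y])
      show "(x, if x = u then p else x) \<in> (adj (delete u G))\<^sup>*" using that by simp
    next
      fix a b assume ab: "{a, b} \<in> edges G" and
        IH: "(x, if a = u then p else a) \<in> (adj (delete u G))\<^sup>*"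
      show "(x, if b = u then p else b) \<in> (adj (delete u G))\<^sup>*"
      proof (cases "a = u \<or> b = u")
        case True
        then show ?thesis using nb[of a] nb[of b] ab IH p by (auto simp: insert_commute)
      next
        case False
        then have "(a, b) \<in> adj (delete u G)" using ab by (auto simp: adj_def)
        then show ?thesis using IH False by (auto intro: rtrancl_into_rtrancl)
      qed
    qed (use that in auto)
    then show ?thesis using that by simp
  qed
  then show ?thesis using p by (auto simp: connected_graph_def adj_def)
qed

lemma connected_graph_has_neighbour:
  assumes "connected_graph G" "u \<in> verts G" "card (verts G) \<ge> 2"
  shows "\<exists>p. {u, p} \<in> edges G"
proof (rule ccontr)
  assume n: "\<not> ?thesis"
  have "verts G \<noteq> {u}" using assms(3) by auto
  then obtain y where y: "y \<in> verts G" "y \<noteq> u" using assms(2) by auto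
  have "y = u"
    by (rule connected_graph_induct[OF assms(1,2) y(1)]) (use n in auto)
  with y show False by simp
qed

text \<open>
  A retraction of \<open>G\<close> onto an embedded copy of the pattern \<open>P\<close> that sends each vertex of \<open>G\<close> to the
  nearest vertex of the copy.
\<close>

definition retractions :: "ugraph \<Rightarrow> ugraph \<Rightarrow> ((nat \<Rightarrow> nat) \<times> (nat \<Rightarrow> nat)) set" where
  "retractions P G = {(\<phi>, \<pi>).
     \<phi> \<in> verts P \<rightarrow>\<^sub>E verts G \<and> \<pi> \<in> verts G \<rightarrow>\<^sub>E verts P \<and>
     (\<forall>u\<in>verts P. \<pi> (\<phi> u) = u) \<and>
     (\<forall>u v. {u, v} \<in> edges P \<longrightarrow> {\<phi> u, \<phi> v} \<in> edges G) \<and>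
     (\<forall>x y. {x, y} \<in> edges G \<longrightarrow>
        \<pi> x = \<pi> y \<or> \<phi> (\<pi> x) = x \<and> \<phi> (\<pi> y) = y \<and> {\<pi> x, \<pi> y} \<in> edges P)}"

text \<open>Degree two in the fibre sizes keeps the second moment at its natural order:
  \<open>pattern_count_le\<close> then leads to sums of squared subtree sizes, while first powers
  would lead to the total depth, which carries a logarithm.\<close>

definition fibre_weight :: "ugraph \<Rightarrow> ugraph \<Rightarrow> (nat \<Rightarrow> nat) \<Rightarrow> real" where
  "fibre_weight P G \<pi> = (\<Prod>u\<in>verts P.
     real (card {x \<in> verts G. \<pi> x = u}) * (real (card {x \<in> verts G. \<pi> x = u}) + 1))"

definition pattern_count :: "ugraph \<Rightarrow> ugraph \<Rightarrow> real" where
  "pattern_count P G = (\<Sum>q\<in>retractions P G. fibre_weight P G (snd q))"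

lemma retractionsI:
  assumes "\<phi> \<in> verts P \<rightarrow>\<^sub>E verts G" "\<pi> \<in> verts G \<rightarrow>\<^sub>E verts P"
    and "\<And>u. u \<in> verts P \<Longrightarrow> \<pi> (\<phi> u) = u"
    and "\<And>u v. {u, v} \<in> edges P \<Longrightarrow> {\<phi> u, \<phi> v} \<in> edges G"
    and "\<And>x y. {x, y} \<in> edges G \<Longrightarrow> \<pi> x \<noteq> \<pi> y \<Longrightarrow>
      \<phi> (\<pi> x) = x \<and> \<phi> (\<pi> y) = y \<and> {\<pi> x, \<pi> y} \<in> edges P"
  shows "(\<phi>, \<pi>) \<in> retractions P G"
  using assms unfolding retractions_def by blast

lemma retractionsD:
  assumes "(\<phi>, \<pi>) \<in> retractions P G"
  shows "\<phi> \<in> verts P \<rightarrow>\<^sub>E verts G" "\<pi> \<in> verts G \<rightarrow>\<^sub>E verts P"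
    and "\<And>u. u \<in> verts P \<Longrightarrow> \<pi> (\<phi> u) = u"
    and "\<And>u v. {u, v} \<in> edges P \<Longrightarrow> {\<phi> u, \<phi> v} \<in> edges G"
    and "\<And>x y. {x, y} \<in> edges G \<Longrightarrow> \<pi> x \<noteq> \<pi> y \<Longrightarrow>
      \<phi> (\<pi> x) = x \<and> \<phi> (\<pi> y) = y \<and> {\<pi> x, \<pi> y} \<in> edges P"
  using assms unfolding retractions_def by blast+

lemma finite_retractions:
  assumes "finite (verts P)" "finite (verts G)"
  shows "finite (retractions P G)"
proof (rule finite_subset)
  show "retractions P G \<subseteq> (verts P \<rightarrow>\<^sub>E verts G) \<times> (verts G \<rightarrow>\<^sub>E verts P)"
    by (auto simp: retractions_def)
  show "finite ((verts P \<rightarrow>\<^sub>E verts G) \<times> (verts G \<rightarrow>\<^sub>E verts P))"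
    using assms by (simp add: finite_PiE)
qed

section \<open>The effect of an attachment on pattern counts\<close>

text \<open>Describes \<open>attach G v\<close> without reference to how \<open>fresh\<close> picks
  the new vertex \<open>w\<close>.\<close>

locale leaf_extension =
  fixes G G' :: ugraph and w v :: nat
  assumes G: "simple_graph G" and v: "v \<in> verts G" and w: "w \<notin> verts G"
    and V: "verts G' = insert w (verts G)" and E: "edges G' = insert {w, v} (edges G)"
begin

lemma edge_extension_iff:
  "{x, y} \<in> edges G' \<longleftrightarrow> x = w \<and> y = v \<or> x = v \<and> y = w \<or> {x, y} \<in> edges G"
  by (auto simp: E doubleton_eq_iff)

lemma edge_vertices: "{x, y} \<in> edges G \<Longrightarrow> x \<in> verts G \<and> y \<in> verts G \<and> x \<noteq> w \<and> y \<noteq> w"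
  using simple_graph_edgeD[OF G, of x y] w by auto

lemma finite_verts: "finite (verts G)"
  using G by (simp add: simple_graph_def)

text \<open>When the copy avoids \<open>w\<close>, the condition on the edge \<open>{w, v}\<close>
  forces \<open>\<pi> w = \<pi> v\<close>, since otherwise \<open>w\<close> would be the point
  \<open>\<phi> (\<pi> w)\<close> of the copy. Restriction to \<open>G\<close> and extension by this
  value are therefore mutually inverse.\<close>

lemma sum_retractions_old:
  assumes P: "simple_graph P"
  shows "(\<Sum>q\<in>{q \<in> retractions P G'. w \<notin> fst q ` verts P}. h (snd q)) =
    (\<Sum>q\<in>retractions P G. h ((snd q)(w := snd q v)))"
proof (rule sum.reindex_bij_witness[of _ "\<lambda>q. (fst q, (snd q)(w := snd q v))"
      "\<lambda>q. (fst q, restrict (snd q) (verts G))"])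
  fix q assume "q \<in> {q \<in> retractions P G'. w \<notin> fst q ` verts P}"
  then obtain \<phi> \<pi> where q: "q = (\<phi>, \<pi>)" "(\<phi>, \<pi>) \<in> retractions P G'" "w \<notin> \<phi> ` verts P"
    by (cases q) auto
  note r = retractionsD[OF q(2), unfolded V E]
  have \<pi>: "\<pi> w \<in> verts P" "\<pi> \<in> extensional (insert w (verts G))" using r(2) by (auto simp: PiE_def)
  have "\<pi> w = \<pi> v" using r(5)[of w v] q(3) \<pi>(1) by (metis image_eqI insertI1)
  moreover have "\<pi> x = undefined" if "x \<noteq> w" "x \<notin> verts G" for x
    using \<pi>(2) that by (auto simp: extensional_def)
  ultimately have *: "(restrict \<pi> (verts G))(w := restrict \<pi> (verts G) v) = \<pi>"
    using v by (auto simp: fun_eq_iff)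
  then show "(fst (fst q, restrict (snd q) (verts G)),
      (snd (fst q, restrict (snd q) (verts G)))
      (w := snd (fst q, restrict (snd q) (verts G)) v)) = q"
    by (simp add: q)
  have \<phi>: "\<phi> u \<in> verts G" if "u \<in> verts P" for u
    using r(1) q(3) that by (auto simp: PiE_def Pi_def)
  have "(\<phi>, restrict \<pi> (verts G)) \<in> retractions P G"
  proof (rule retractionsI)
    show "\<phi> \<in> verts P \<rightarrow>\<^sub>E verts G" using r(1) \<phi> by (auto simp: PiE_def)
    show "restrict \<pi> (verts G) \<in> verts G \<rightarrow>\<^sub>E verts P" using r(2) by auto
    show "{\<phi> u, \<phi> u'} \<in> edges G" if "{u, u'} \<in> edges P" for u u'
    proof -
      have e: "{\<phi> u, \<phi> u'} \<in> edges G'" using r(4)[OF that] by (simp add: E)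
      have "\<phi> u \<noteq> w" "\<phi> u' \<noteq> w" using \<phi> simple_graph_edgeD[OF P that] w by auto
      then show ?thesis using e unfolding edge_extension_iff by blast
    qed
    show "restrict \<pi> (verts G) (\<phi> u) = u" if "u \<in> verts P" for u
      using \<phi>[OF that] r(3)[OF that] by simp
    fix x y assume xy: "{x, y} \<in> edges G" "restrict \<pi> (verts G) x \<noteq> restrict \<pi> (verts G) y"
    then have "x \<in> verts G" "y \<in> verts G" using edge_vertices by auto
    then show "\<phi> (restrict \<pi> (verts G) x) = x \<and> \<phi> (restrict \<pi> (verts G) y) = y \<and>
        {restrict \<pi> (verts G) x, restrict \<pi> (verts G) y} \<in> edges P"
      using r(5)[of x y] xy by simp
  qed
  then show "(fst q, restrict (snd q) (verts G)) \<in> retractions P G" by (simp add: q)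
  show "h ((snd (fst q, restrict (snd q) (verts G)))
      (w := snd (fst q, restrict (snd q) (verts G)) v)) = h (snd q)"
    using * by (simp add: q)
next
  fix q assume "q \<in> retractions P G"
  then obtain \<phi> \<pi> where q: "q = (\<phi>, \<pi>)" "(\<phi>, \<pi>) \<in> retractions P G" by (cases q) auto
  note r = retractionsD[OF q(2)]
  have \<phi>: "\<phi> u \<in> verts G" "\<phi> u \<noteq> w" if "u \<in> verts P" for u
    using r(1) w that by (auto simp: PiE_def Pi_def)
  have "restrict (\<pi>(w := \<pi> v)) (verts G) = \<pi>"
    using w r(2) by (auto simp: fun_eq_iff restrict_def PiE_def extensional_def)
  then show "(fst (fst q, (snd q)(w := snd q v)),
      restrict (snd (fst q, (snd q)(w := snd q v))) (verts G)) = q"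
    by (simp add: q)
  have "(\<phi>, \<pi>(w := \<pi> v)) \<in> retractions P G'"
  proof (rule retractionsI)
    show "\<phi> \<in> verts P \<rightarrow>\<^sub>E verts G'" unfolding V using r(1) by (auto simp: PiE_def)
    show "\<pi>(w := \<pi> v) \<in> verts G' \<rightarrow>\<^sub>E verts P"
      unfolding V using r(2) v by (auto simp: PiE_def extensional_def)
    show "(\<pi>(w := \<pi> v)) (\<phi> u) = u" if "u \<in> verts P" for u using \<phi>[OF that] r(3)[OF that] by simp
    show "{\<phi> u, \<phi> u'} \<in> edges G'" if "{u, u'} \<in> edges P" for u u' using r(4)[OF that] by (simp add: edge_extension_iff)
    fix x y assume xy: "{x, y} \<in> edges G'" "(\<pi>(w := \<pi> v)) x \<noteq> (\<pi>(w := \<pi> v)) y"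
    then have "{x, y} \<in> edges G" using xy(1)[unfolded edge_extension_iff] by auto
    moreover from this have "x \<noteq> w" "y \<noteq> w" using edge_vertices w by auto
    ultimately show "\<phi> ((\<pi>(w := \<pi> v)) x) = x \<and> \<phi> ((\<pi>(w := \<pi> v)) y) = y \<and>
        {(\<pi>(w := \<pi> v)) x, (\<pi>(w := \<pi> v)) y} \<in> edges P"
      using r(5)[of x y] xy by simp
  qed
  then show "(fst q, (snd q)(w := snd q v)) \<in> {q \<in> retractions P G'. w \<notin> fst q ` verts P}"
    using \<phi> by (auto simp: q)
qed

text \<open>The only neighbour of \<open>w\<close> is \<open>v\<close>, so all neighbours of
  \<open>u\<close> are sent to \<open>v\<close>, and \<open>\<pi>\<close> shows that there is just
  one. A walk inside \<open>G\<close> could enter the fibre of \<open>u\<close> only at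
  \<open>\<phi> u = w\<close>, hence that fibre contains no vertex of \<open>G\<close>.\<close>

lemma retraction_new:
  assumes P: "simple_graph P" "connected_graph P" "card (verts P) \<ge> 2" and cG: "connected_graph G"
    and q: "(\<phi>, \<pi>) \<in> retractions P G'" and u: "u \<in> verts P" and uw: "\<phi> u = w"
  shows "\<exists>p. neighbours P u = {p} \<and> \<phi> p = v \<and> p \<noteq> u \<and> p \<in> verts P"
    and "\<And>x. x \<in> verts G \<Longrightarrow> \<pi> x \<noteq> u"
    and "\<And>u'. u' \<in> verts P \<Longrightarrow> u' \<noteq> u \<Longrightarrow> \<phi> u' \<in> verts G"
proof -
  note r = retractionsD[OF q, unfolded V]
  have vw: "v \<noteq> w" using v w by auto
  have nv: "\<phi> u' = v" if "{u, u'} \<in> edges P" for u'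
    using r(4)[OF that] vw edge_vertices by (auto simp: uw edge_extension_iff)
  obtain p where p: "{u, p} \<in> edges P" using connected_graph_has_neighbour[OF P(2) u P(3)] ..
  have pP: "p \<in> verts P" "u \<noteq> p" using simple_graph_edgeD[OF P(1) p] by auto
  have un: "u' = p" if "{u, u'} \<in> edges P" for u'
    using r(3)[of u'] r(3)[of p] nv[OF that] nv[OF p] simple_graph_edgeD[OF P(1) that] pP by simp
  have "neighbours P u = {p}" unfolding neighbours_def using un p by blast
  then show "\<exists>p. neighbours P u = {p} \<and> \<phi> p = v \<and> p \<noteq> u \<and> p \<in> verts P"
    using nv[OF p] pP by auto
  show "\<pi> x \<noteq> u" if x: "x \<in> verts G" for x
  proof (rule connected_graph_induct[OF cG v x])
    show "\<pi> v \<noteq> u" using r(3)[OF pP(1)] nv[OF p] pP by simp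
    fix a b assume ab: "{a, b} \<in> edges G" "\<pi> a \<noteq> u"
    then have "{a, b} \<in> edges G'" by (simp add: E)
    from r(5)[OF this] ab edge_vertices[OF ab(1)] uw show "\<pi> b \<noteq> u" by metis
  qed
  show "\<phi> u' \<in> verts G" if "u' \<in> verts P" "u' \<noteq> u" for u'
    using r(1) r(3)[OF that(1)] r(3)[OF u] uw that by (metis PiE_mem insertE)
qed

text \<open>The factor \<open>2\<close> is \<open>c * (c + 1)\<close> for the singleton fibre
  \<open>{w}\<close>.\<close>

lemma fibre_weight_new:
  assumes P: "finite (verts P)" and u: "u \<in> verts P" and \<pi>: "\<And>x. x \<in> verts G \<Longrightarrow> \<pi> x \<noteq> u"
  shows "fibre_weight P G' (\<pi>(w := u)) = 2 * fibre_weight (delete u P) G \<pi>"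
proof -
  have "{x \<in> verts G'. (\<pi>(w := u)) x = u} = {w}" using \<pi> w by (auto simp: V)
  moreover have "{x \<in> verts G'. (\<pi>(w := u)) x = a} = {x \<in> verts G. \<pi> x = a}" if "a \<noteq> u" for a
    using that w by (auto simp: V)
  ultimately show ?thesis
    unfolding fibre_weight_def using P u by (subst prod.remove[of _ u]) (auto intro!: prod.cong)
qed

text \<open>By \<open>retraction_new\<close>, a copy of \<open>P\<close> with the leaf
  \<open>u\<close> at \<open>w\<close> amounts to a copy of \<open>delete u P\<close> with
  \<open>p\<close> at \<open>v\<close>, to which \<open>w\<close> is added as a fibre of its
  own.\<close>

lemma sum_retractions_new:
  assumes P: "simple_graph P" "connected_graph P" "card (verts P) \<ge> 2" and cG: "connected_graph G"
    and u: "u \<in> verts P" and p: "neighbours P u = {p}"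
  shows "(\<Sum>q\<in>{q \<in> retractions P G'. fst q u = w}. fibre_weight P G' (snd q)) =
    (\<Sum>q\<in>{q \<in> retractions (delete u P) G. fst q p = v}. 2 * fibre_weight (delete u P) G (snd q))"
proof -
  have up: "{u, p} \<in> edges P" using p by (auto simp: neighbours_def)
  have pP: "p \<in> verts P" "u \<noteq> p" using simple_graph_edgeD[OF P(1) up] by auto
  have nb: "u' = p" if "{u, u'} \<in> edges P \<or> {u', u} \<in> edges P" for u'
  proof -
    have "u' \<in> neighbours P u" using that by (auto simp: neighbours_def insert_commute)
    then show ?thesis using p by simp
  qed
  have fP: "finite (verts P)" using P(1) by (simp add: simple_graph_def)
  let ?i = "\<lambda>q. ((fst q)(u := w), (snd q)(w := u))"
  let ?j = "\<lambda>q. (restrict (fst q) (verts P - {u}), restrict (snd q) (verts G))"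
  show ?thesis
  proof (rule sum.reindex_bij_witness[of _ ?i ?j])
    fix q assume "q \<in> {q \<in> retractions P G'. fst q u = w}"
    then obtain \<phi> \<pi> where q: "q = (\<phi>, \<pi>)" "(\<phi>, \<pi>) \<in> retractions P G'" "\<phi> u = w"
      by (cases q) auto
    note r = retractionsD[OF q(2), unfolded V]
    note n = retraction_new[OF P cG q(2) u q(3)]
    have \<phi>p: "\<phi> p = v" using n(1) p by auto
    have \<pi>w: "\<pi> w = u" using r(3)[OF u] q(3) by simp
    have \<phi>e: "\<phi> \<in> extensional (verts P)" and \<pi>e: "\<pi> \<in> extensional (insert w (verts G))"
      using r(1,2) by (auto simp: PiE_def)
    have 1: "(restrict \<phi> (verts P - {u}))(u := w) = \<phi>"
      using \<phi>e q(3) by (auto simp: fun_eq_iff extensional_def)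
    have 2: "(restrict \<pi> (verts G))(w := u) = \<pi>"
      using \<pi>e \<pi>w by (auto simp: fun_eq_iff extensional_def)
    show "?i (?j q) = q" by (simp add: q 1 2)
    have "(restrict \<phi> (verts P - {u}), restrict \<pi> (verts G)) \<in> retractions (delete u P) G"
    proof (rule retractionsI)
      show "restrict \<phi> (verts P - {u}) \<in> verts (delete u P) \<rightarrow>\<^sub>E verts G" using n(3) by auto
      show "restrict \<pi> (verts G) \<in> verts G \<rightarrow>\<^sub>E verts (delete u P)"
        using r(2) n(2) by (auto simp: PiE_def Pi_def)
      show "restrict \<pi> (verts G) (restrict \<phi> (verts P - {u}) a) = a" if "a \<in> verts (delete u P)" for a
        using that n(3)[of a] r(3)[of a] by simp
      show "{restrict \<phi> (verts P - {u}) a, restrict \<phi> (verts P - {u}) b} \<in> edges G"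
        if "{a, b} \<in> edges (delete u P)" for a b
      proof -
        have ab: "{a, b} \<in> edges P" "a \<noteq> u" "b \<noteq> u" using that by auto
        then have abP: "a \<in> verts P" "b \<in> verts P" using simple_graph_edgeD[OF P(1)] by auto
        then have "\<phi> a \<noteq> w" "\<phi> b \<noteq> w" using n(3) ab w by metis+
        then show ?thesis using r(4)[OF ab(1)] ab abP by (auto simp: edge_extension_iff)
      qed
      fix x y assume xy: "{x, y} \<in> edges G" "restrict \<pi> (verts G) x \<noteq> restrict \<pi> (verts G) y"
      then have xyG: "x \<in> verts G" "y \<in> verts G" using edge_vertices by auto
      have "{x, y} \<in> edges G'" using xy by (simp add: E)
      then have *: "\<phi> (\<pi> x) = x \<and> \<phi> (\<pi> y) = y \<and> {\<pi> x, \<pi> y} \<in> edges P"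
        using r(5)[of x y] xy(2) xyG by simp
      moreover have "\<pi> x \<in> verts P" "\<pi> y \<in> verts P" using r(2) xyG by auto
      ultimately show "restrict \<phi> (verts P - {u}) (restrict \<pi> (verts G) x) = x \<and>
          restrict \<phi> (verts P - {u}) (restrict \<pi> (verts G) y) = y \<and>
          {restrict \<pi> (verts G) x, restrict \<pi> (verts G) y} \<in> edges (delete u P)"
        using n(2) xyG by auto
    qed
    then show "?j q \<in> {q \<in> retractions (delete u P) G. fst q p = v}"
      using pP \<phi>p by (simp add: q)
    have "fibre_weight P G' ((restrict \<pi> (verts G))(w := u)) =
        2 * fibre_weight (delete u P) G (restrict \<pi> (verts G))"
      by (rule fibre_weight_new[OF fP u]) (use n(2) in auto)
    then show "2 * fibre_weight (delete u P) G (snd (?j q)) = fibre_weight P G' (snd q)"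
      by (simp add: q 2)
  next
    fix q assume "q \<in> {q \<in> retractions (delete u P) G. fst q p = v}"
    then obtain \<phi> \<pi> where q: "q = (\<phi>, \<pi>)" "(\<phi>, \<pi>) \<in> retractions (delete u P) G" "\<phi> p = v"
      by (cases q) auto
    note r = retractionsD[OF q(2), unfolded verts_delete]
    have \<phi>V: "\<phi> a \<in> verts G" "\<phi> a \<noteq> w" if "a \<in> verts P" "a \<noteq> u" for a
      using r(1) w that by (auto simp: PiE_def Pi_def)
    have \<pi>V: "\<pi> x \<in> verts P" "\<pi> x \<noteq> u" if "x \<in> verts G" for x using r(2) that by auto
    have \<phi>e: "\<phi> \<in> extensional (verts P - {u})" and \<pi>e: "\<pi> \<in> extensional (verts G)"
      using r(1,2) by (auto simp: PiE_def)
    have "restrict (\<phi>(u := w)) (verts P - {u}) = \<phi>"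
      using \<phi>e by (auto simp: fun_eq_iff extensional_def)
    moreover have "restrict (\<pi>(w := u)) (verts G) = \<pi>"
      using \<pi>e w by (auto simp: fun_eq_iff extensional_def)
    ultimately show "?j (?i q) = q" by (simp add: q)
    have \<pi>v: "\<pi> v = p" using r(3)[of p] q(3) pP by auto
    have "(\<phi>(u := w), \<pi>(w := u)) \<in> retractions P G'"
    proof (rule retractionsI)
      show "\<phi>(u := w) \<in> verts P \<rightarrow>\<^sub>E verts G'"
        using \<phi>V \<phi>e u by (auto simp: V PiE_def extensional_def)
      show "\<pi>(w := u) \<in> verts G' \<rightarrow>\<^sub>E verts P"
        using \<pi>V \<pi>e u by (auto simp: V PiE_def extensional_def)
      show "(\<pi>(w := u)) ((\<phi>(u := w)) a) = a" if "a \<in> verts P" for a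
        using that r(3)[of a] \<phi>V[of a] by auto
      show "{(\<phi>(u := w)) a, (\<phi>(u := w)) b} \<in> edges G'" if ab: "{a, b} \<in> edges P" for a b
      proof -
        have ne: "a \<noteq> b" using simple_graph_edgeD[OF P(1) ab] by simp
        consider "a = u" "b = p" | "b = u" "a = p" | "a \<noteq> u" "b \<noteq> u" using nb ab by blast
        then show ?thesis
        proof cases
          case 3
          then show ?thesis using r(4)[of a b] ab by (simp add: E)
        qed (use q(3) pP in \<open>auto simp: edge_extension_iff\<close>)
      qed
      fix x y assume xy: "{x, y} \<in> edges G'" "(\<pi>(w := u)) x \<noteq> (\<pi>(w := u)) y"
      consider "x = w" "y = v" | "x = v" "y = w" | "{x, y} \<in> edges G"
        using xy(1) unfolding edge_extension_iff by blast
      then show "(\<phi>(u := w)) ((\<pi>(w := u)) x) = x \<and> (\<phi>(u := w)) ((\<pi>(w := u)) y) = y \<and>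
          {(\<pi>(w := u)) x, (\<pi>(w := u)) y} \<in> edges P"
      proof cases
        case 3
        then have "x \<noteq> w" "y \<noteq> w" "x \<in> verts G" "y \<in> verts G" using edge_vertices by auto
        then show ?thesis using r(5)[OF 3] xy(2) \<pi>V by auto
      qed (use v w \<pi>v q(3) pP up in \<open>auto simp: insert_commute\<close>)
    qed
    then show "?i q \<in> {q \<in> retractions P G'. fst q u = w}" by (simp add: q)
  qed
qed

end

section \<open>Averaging over the point of attachment\<close>

definition leaves :: "ugraph \<Rightarrow> nat set" where
  "leaves P = {u \<in> verts P. \<exists>p. neighbours P u = {p}}"

lemma leaf_extension_attach:
  assumes "simple_graph G" "v \<in> verts G"
  shows "leaf_extension G (attach G v) (fresh G) v"
  using assms fresh_notin[of G] by unfold_locales (auto simp: simple_graph_def)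

text \<open>The urn step. For a fibre of size \<open>c\<close> there are \<open>c\<close> choices of
  \<open>v\<close> that enlarge it, and
  \<open>c * ((c + 1) * (c + 2)) = (c + 2) * (c * (c + 1))\<close>. Summing \<open>c + 2\<close>
  over the fibres gives the factor, because the fibres partition the vertices.\<close>

lemma sum_fibre_weight_attach:
  assumes G: "simple_graph G" and P: "finite (verts P)" and \<pi>: "\<pi> \<in> verts G \<rightarrow> verts P"
  shows "(\<Sum>v\<in>verts G. fibre_weight P (attach G v) (\<pi>(fresh G := \<pi> v))) =
    (real (card (verts G)) + 2 * real (card (verts P))) * fibre_weight P G \<pi>"
proof -
  define c where "c u = card {x \<in> verts G. \<pi> x = u}" for u
  define f where "f u = (\<Prod>a\<in>verts P. real (c a + of_bool (a = u)) * (real (c a + of_bool (a = u)) + 1))" for u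
  have fin: "finite (verts G)" using G by (simp add: simple_graph_def)
  have w: "fresh G \<notin> verts G" using fresh_notin[OF fin] .
  have cv: "card {x \<in> verts (attach G v). (\<pi>(fresh G := u)) x = a} = c a + of_bool (a = u)" for u v a
  proof -
    have "{x \<in> verts (attach G v). (\<pi>(fresh G := u)) x = a} =
        (if a = u then insert (fresh G) {x \<in> verts G. \<pi> x = a} else {x \<in> verts G. \<pi> x = a})"
      using w by auto
    then show ?thesis using w fin by (auto simp: c_def)
  qed
  have "real (c u) * f u = (real (c u) + 2) * fibre_weight P G \<pi>" if u: "u \<in> verts P" for u
  proof -
    have "f u = real (c u + 1) * (real (c u + 1) + 1) *
        (\<Prod>a\<in>verts P - {u}. real (c a) * (real (c a) + 1))"
      unfolding f_def by (subst prod.remove[OF P u]) (auto intro!: prod.cong)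
    moreover have "fibre_weight P G \<pi> = real (c u) * (real (c u) + 1) *
        (\<Prod>a\<in>verts P - {u}. real (c a) * (real (c a) + 1))"
      unfolding fibre_weight_def c_def by (subst prod.remove[OF P u]) auto
    ultimately show ?thesis by (simp add: algebra_simps)
  qed
  then have fc: "(\<Sum>u\<in>verts P. real (c u) * f u) = (\<Sum>u\<in>verts P. (real (c u) + 2) * fibre_weight P G \<pi>)"
    by (intro sum.cong) auto
  have "(\<Sum>v\<in>verts G. fibre_weight P (attach G v) (\<pi>(fresh G := \<pi> v))) = (\<Sum>v\<in>verts G. f (\<pi> v))"
    unfolding fibre_weight_def f_def cv ..
  also have "\<dots> = (\<Sum>u\<in>verts P. \<Sum>v\<in>{v \<in> verts G. \<pi> v = u}. f (\<pi> v))"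
    using \<pi> by (subst sum.group[OF fin P]) auto
  also have "\<dots> = (\<Sum>u\<in>verts P. (real (c u) + 2) * fibre_weight P G \<pi>)"
  proof -
    have "(\<Sum>v\<in>{v \<in> verts G. \<pi> v = u}. f (\<pi> v)) = real (c u) * f u" for u
    proof -
      have "(\<Sum>v\<in>{v \<in> verts G. \<pi> v = u}. f (\<pi> v)) = (\<Sum>v\<in>{v \<in> verts G. \<pi> v = u}. f u)"
        by (rule sum.cong) auto
      then show ?thesis by (simp add: c_def)
    qed
    then show ?thesis by (simp only: fc)
  qed
  also have "\<dots> = ((\<Sum>u\<in>verts P. real (c u)) + 2 * real (card (verts P))) * fibre_weight P G \<pi>"
    unfolding sum_distrib_right[symmetric] by (simp add: sum.distrib)
  also have "(\<Sum>u\<in>verts P. real (c u)) = real (card (verts G))"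
    using sum.group[OF fin P, of \<pi> "\<lambda>_. 1 :: real"] \<pi> by (auto simp: c_def)
  finally show ?thesis .
qed

text \<open>The new vertex either joins the fibre of its neighbour, which is the urn step, or is
  itself the image of a leaf of \<open>P\<close>. Single-vertex patterns, which have no leaf to
  delete, are evaluated in \<open>pattern_count_singleton\<close>.\<close>

lemma sum_pattern_count_attach:
  assumes P: "simple_graph P" "connected_graph P" "card (verts P) \<ge> 2"
    and sG: "simple_graph G" "connected_graph G"
  shows "(\<Sum>v\<in>verts G. pattern_count P (attach G v)) =
    (real (card (verts G)) + 2 * real (card (verts P))) * pattern_count P G +
    2 * (\<Sum>u\<in>leaves P. pattern_count (delete u P) G)"
proof -
  have fP: "finite (verts P)" and fG: "finite (verts G)" using P sG by (auto simp: simple_graph_def)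
  let ?w = "fresh G"
  define A where "A v = {q \<in> retractions P (attach G v). ?w \<notin> fst q ` verts P}" for v
  define B where "B v u = {q \<in> retractions P (attach G v). fst q u = ?w}" for v u
  define nb where "nb u = (THE p. neighbours P u = {p})" for u
  have nb: "neighbours P u = {nb u}" if "u \<in> leaves P" for u
    using that by (auto simp: leaves_def nb_def)
  \<comment> \<open>\<open>A v\<close> collects the copies that avoid the new vertex,
    \<open>B v u\<close> those that place the leaf \<open>u\<close> on it; by
    \<open>retraction_new\<close> nothing else can lie on it.\<close>
  have split: "pattern_count P (attach G v) =
      (\<Sum>q\<in>A v. fibre_weight P (attach G v) (snd q)) +
      (\<Sum>u\<in>leaves P. \<Sum>q\<in>B v u. fibre_weight P (attach G v) (snd q))"
    (is "_ = _ + ?s") if v: "v \<in> verts G" for v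
  proof -
    interpret leaf_extension G "attach G v" ?w v using leaf_extension_attach[OF sG(1) v] .
    let ?R = "retractions P (attach G v)"
    have fR: "finite ?R" using fP fG by (intro finite_retractions) auto
    have disj: "B v u \<inter> B v u' = {}" if "u \<in> leaves P" "u' \<in> leaves P" "u \<noteq> u'" for u u'
    proof (rule ccontr)
      assume "B v u \<inter> B v u' \<noteq> {}"
      then obtain \<phi> \<pi> where q: "(\<phi>, \<pi>) \<in> ?R" "\<phi> u = ?w" "\<phi> u' = ?w" by (auto simp: B_def)
      then show False using retractionsD(3)[OF q(1), of u] retractionsD(3)[OF q(1), of u'] that
        by (auto simp: leaves_def)
    qed
    have "?R - A v = (\<Union>u\<in>leaves P. B v u)"
    proof (intro equalityI subsetI)
      fix q assume "q \<in> ?R - A v"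
      then obtain u where u: "q \<in> ?R" "u \<in> verts P" "fst q u = ?w" by (auto simp: A_def)
      obtain \<phi> \<pi> where q: "q = (\<phi>, \<pi>)" by (cases q)
      have "u \<in> leaves P"
        using retraction_new(1)[OF P sG(2), of \<phi> \<pi> u] u q by (auto simp: leaves_def)
      then show "q \<in> (\<Union>u\<in>leaves P. B v u)" using u by (auto simp: B_def)
    next
      fix q assume "q \<in> (\<Union>u\<in>leaves P. B v u)"
      then show "q \<in> ?R - A v" by (force simp: A_def B_def leaves_def)
    qed
    then have "?s = (\<Sum>q\<in>?R - A v. fibre_weight P (attach G v) (snd q))"
      using fP fR disj by (subst sum.UNION_disjoint[symmetric]) (auto simp: B_def leaves_def)
    moreover have "A v \<subseteq> ?R" by (auto simp: A_def)
    ultimately show ?thesis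
      unfolding pattern_count_def using sum.subset_diff[OF _ fR] by (simp add: add.commute)
  qed
  have "(\<Sum>v\<in>verts G. \<Sum>q\<in>A v. fibre_weight P (attach G v) (snd q)) =
      (\<Sum>v\<in>verts G. \<Sum>q\<in>retractions P G. fibre_weight P (attach G v) ((snd q)(?w := snd q v)))"
    unfolding A_def
    by (intro sum.cong refl leaf_extension.sum_retractions_old leaf_extension_attach sG P)
  also have "\<dots> = (\<Sum>q\<in>retractions P G.
      (real (card (verts G)) + 2 * real (card (verts P))) * fibre_weight P G (snd q))"
    by (subst sum.swap)
      (intro sum.cong refl sum_fibre_weight_attach sG fP, auto simp: retractions_def)
  finally have 1: "(\<Sum>v\<in>verts G. \<Sum>q\<in>A v. fibre_weight P (attach G v) (snd q)) =
      (real (card (verts G)) + 2 * real (card (verts P))) * pattern_count P G"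
    by (simp add: pattern_count_def sum_distrib_left)
  have 2: "(\<Sum>v\<in>verts G. \<Sum>q\<in>B v u. fibre_weight P (attach G v) (snd q)) =
      2 * pattern_count (delete u P) G" if u: "u \<in> leaves P" for u
  proof -
    have uP: "u \<in> verts P" using u by (simp add: leaves_def)
    have "{u, nb u} \<in> edges P" using nb[OF u] by (auto simp: neighbours_def)
    then have p: "nb u \<in> verts P" "nb u \<noteq> u" using simple_graph_edgeD[OF P(1), of u "nb u"] by auto
    let ?D = "retractions (delete u P) G"
    have fD: "finite ?D" using fP fG by (intro finite_retractions) auto
    have "(\<Sum>v\<in>verts G. \<Sum>q\<in>B v u. fibre_weight P (attach G v) (snd q)) =
        (\<Sum>v\<in>verts G. \<Sum>q\<in>{q \<in> ?D. fst q (nb u) = v}. 2 * fibre_weight (delete u P) G (snd q))"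
      unfolding B_def
      by (intro sum.cong refl leaf_extension.sum_retractions_new leaf_extension_attach sG P uP nb u)
    \<comment> \<open>Every copy of \<open>delete u P\<close> places the neighbour of
      \<open>u\<close> at exactly one \<open>v\<close>, so the sum over \<open>v\<close> removes
      that restriction.\<close>
    also have "\<dots> = (\<Sum>q\<in>?D. 2 * fibre_weight (delete u P) G (snd q))"
      using p by (intro sum.group fD fG) (auto simp: retractions_def)
    finally show ?thesis by (simp add: pattern_count_def sum_distrib_left)
  qed
  have "(\<Sum>v\<in>verts G. pattern_count P (attach G v)) =
     (\<Sum>v\<in>verts G. \<Sum>q\<in>A v. fibre_weight P (attach G v) (snd q)) +
     (\<Sum>u\<in>leaves P. \<Sum>v\<in>verts G. \<Sum>q\<in>B v u. fibre_weight P (attach G v) (snd q))"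
    by (subst sum.swap) (simp add: split sum.distrib)
  then show ?thesis by (simp add: 1 2 sum_distrib_left)
qed

section \<open>Special values and isomorphism invariance of pattern counts\<close>

lemma fibre_weight_nonneg: "fibre_weight P G \<pi> \<ge> 0"
  by (auto simp: fibre_weight_def intro!: prod_nonneg)

lemma pattern_count_nonneg: "pattern_count P G \<ge> 0"
  by (auto simp: pattern_count_def intro!: sum_nonneg fibre_weight_nonneg)

text \<open>The bottom of the recursion over patterns: the value depends on the size of
  \<open>G\<close> alone, so single-vertex patterns never tell two seeds apart.\<close>

lemma pattern_count_singleton:
  assumes P: "simple_graph P" "verts P = {u}" and G: "simple_graph G"
  shows "pattern_count P G = real (card (verts G)) * (real (card (verts G)) * (real (card (verts G)) + 1))"
proof -
  let ?c = "\<lambda>x. (restrict (\<lambda>_. x) {u}, restrict (\<lambda>_. u) (verts G))"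
  have nE: "e \<notin> edges P" for e
  proof
    assume "e \<in> edges P"
    then have "e \<subseteq> {u}" "card e = 2" using P by (auto simp: simple_graph_def)
    then show False using card_mono[of "{u}" e] by simp
  qed
  have "retractions P G = ?c ` verts G"
  proof (intro equalityI subsetI)
    fix q assume "q \<in> retractions P G"
    then obtain \<phi> \<pi> where q: "q = (\<phi>, \<pi>)" "(\<phi>, \<pi>) \<in> retractions P G" by (cases q) auto
    note r = retractionsD(1,2)[OF q(2), unfolded P(2)]
    have "\<phi> = restrict (\<lambda>_. \<phi> u) {u}" using r(1) by (auto simp: fun_eq_iff PiE_def extensional_def)
    moreover have "\<pi> = restrict (\<lambda>_. u) (verts G)"
      using r(2) by (auto simp: fun_eq_iff PiE_def extensional_def)
    ultimately have "q = ?c (\<phi> u)" using q(1) by metis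
    moreover have "\<phi> u \<in> verts G" using r(1) by auto
    ultimately show "q \<in> ?c ` verts G" by blast
  next
    fix q assume "q \<in> ?c ` verts G"
    then obtain x where x: "x \<in> verts G" "q = ?c x" by blast
    show "q \<in> retractions P G"
      unfolding x(2) by (rule retractionsI) (use x nE P(2) simple_graph_edgeD[OF G] in auto)
  qed
  moreover have "inj_on ?c (verts G)"
    by (rule inj_onI) (metis fst_conv restrict_apply' singletonI)
  moreover have "fibre_weight P G (restrict (\<lambda>_. u) (verts G)) =
      real (card (verts G)) * (real (card (verts G)) + 1)"
    by (simp add: fibre_weight_def P(2) cong: conj_cong)
  ultimately show ?thesis by (simp add: pattern_count_def sum.reindex)
qed

lemma retractions_map_iso:
  assumes q: "(\<phi>, \<pi>) \<in> retractions P G" and P: "simple_graph P" and H: "simple_graph H"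
    and f: "\<And>x. x \<in> verts G \<Longrightarrow> f x \<in> verts H \<and> g (f x) = x"
    and g: "\<And>y. y \<in> verts H \<Longrightarrow> g y \<in> verts G \<and> f (g y) = y"
    and e: "\<And>x y. x \<in> verts G \<Longrightarrow> y \<in> verts G \<Longrightarrow> {x, y} \<in> edges G \<longleftrightarrow> {f x, f y} \<in> edges H"
  shows "(restrict (f \<circ> \<phi>) (verts P), restrict (\<pi> \<circ> g) (verts H)) \<in> retractions P H"
proof (rule retractionsI)
  note r = retractionsD[OF q]
  have \<phi>: "\<phi> u \<in> verts G" if "u \<in> verts P" for u using r(1) that by auto
  have \<pi>: "\<pi> x \<in> verts P" if "x \<in> verts G" for x using r(2) that by auto
  show "restrict (f \<circ> \<phi>) (verts P) \<in> verts P \<rightarrow>\<^sub>E verts H" using \<phi> f by auto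
  show "restrict (\<pi> \<circ> g) (verts H) \<in> verts H \<rightarrow>\<^sub>E verts P" using \<pi> g by auto
  show "restrict (\<pi> \<circ> g) (verts H) (restrict (f \<circ> \<phi>) (verts P) u) = u" if "u \<in> verts P" for u
    using that \<phi> f r(3) by simp
  show "{restrict (f \<circ> \<phi>) (verts P) u, restrict (f \<circ> \<phi>) (verts P) v} \<in> edges H"
    if "{u, v} \<in> edges P" for u v
    using simple_graph_edgeD[OF P that] r(4)[OF that] \<phi> e by simp
  fix x y assume xy: "{x, y} \<in> edges H" "restrict (\<pi> \<circ> g) (verts H) x \<noteq> restrict (\<pi> \<circ> g) (verts H) y"
  have V: "x \<in> verts H" "y \<in> verts H" using simple_graph_edgeD[OF H xy(1)] by auto
  then have "{g x, g y} \<in> edges G" using e[of "g x" "g y"] g xy by simp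
  then have *: "\<phi> (\<pi> (g x)) = g x \<and> \<phi> (\<pi> (g y)) = g y \<and> {\<pi> (g x), \<pi> (g y)} \<in> edges P"
    using r(5)[of "g x" "g y"] xy V by simp
  then show "restrict (f \<circ> \<phi>) (verts P) (restrict (\<pi> \<circ> g) (verts H) x) = x \<and>
       restrict (f \<circ> \<phi>) (verts P) (restrict (\<pi> \<circ> g) (verts H) y) = y \<and>
       {restrict (\<pi> \<circ> g) (verts H) x, restrict (\<pi> \<circ> g) (verts H) y} \<in> edges P"
    using V g \<pi> by simp
qed

text \<open>Retractions are transported in both directions along the isomorphism; this makes pattern
  counts functions of isomorphism classes.\<close>

lemma pattern_count_iso:
  assumes P: "simple_graph P" and G: "simple_graph G" and H: "simple_graph H" and iso: "graph_iso G H"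
  shows "pattern_count P G = pattern_count P H"
proof -
  obtain f where bf: "bij_betw f (verts G) (verts H)"
    and e: "\<And>u v. u \<in> verts G \<Longrightarrow> v \<in> verts G \<Longrightarrow> {u, v} \<in> edges G \<longleftrightarrow> {f u, f v} \<in> edges H"
    using iso unfolding graph_iso_def by blast
  define g where "g = inv_into (verts G) f"
  have f: "f x \<in> verts H \<and> g (f x) = x" if "x \<in> verts G" for x
    using bf that bij_betwE[OF bf] by (auto simp: g_def bij_betw_inv_into_left)
  have g: "g y \<in> verts G \<and> f (g y) = y" if "y \<in> verts H" for y
    using bij_betwE[OF bij_betw_inv_into[OF bf]] bij_betw_inv_into_right[OF bf that] that
    by (auto simp: g_def)
  have e': "{x, y} \<in> edges H \<longleftrightarrow> {g x, g y} \<in> edges G" if "x \<in> verts H" "y \<in> verts H" for x y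
    using e[of "g x" "g y"] g that by simp
  let ?i = "\<lambda>q. (restrict (g \<circ> fst q) (verts P), restrict (snd q \<circ> f) (verts G))"
  let ?j = "\<lambda>q. (restrict (f \<circ> fst q) (verts P), restrict (snd q \<circ> g) (verts H))"
  show ?thesis
    unfolding pattern_count_def
  proof (rule sum.reindex_bij_witness[of _ ?i ?j])
    fix q assume q: "q \<in> retractions P G"
    obtain \<phi> \<pi> where [simp]: "q = (\<phi>, \<pi>)" by (cases q)
    note r = retractionsD(1,2)[OF q[unfolded \<open>q = (\<phi>, \<pi>)\<close>]]
    have \<phi>: "\<phi> u \<in> verts G" if "u \<in> verts P" for u using r(1) that by auto
    show "?i (?j q) = q"
      using r \<phi> f g by (auto simp: fun_eq_iff PiE_def extensional_def)
    show "?j q \<in> retractions P H"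
      using q retractions_map_iso[OF _ P H f g e, of \<phi> \<pi>] by simp
    have "card {y \<in> verts H. restrict (\<pi> \<circ> g) (verts H) y = u} = card {x \<in> verts G. \<pi> x = u}" for u
      by (rule bij_betw_same_card[of g], rule bij_betw_byWitness[of _ f]) (use f g in auto)
    then show "fibre_weight P H (snd (?j q)) = fibre_weight P G (snd q)"
      by (simp add: fibre_weight_def)
  next
    fix q assume q: "q \<in> retractions P H"
    obtain \<phi> \<pi> where [simp]: "q = (\<phi>, \<pi>)" by (cases q)
    note r = retractionsD(1,2)[OF q[unfolded \<open>q = (\<phi>, \<pi>)\<close>]]
    have \<phi>: "\<phi> u \<in> verts H" if "u \<in> verts P" for u using r(1) that by auto
    show "?j (?i q) = q"
      using r \<phi> f g by (auto simp: fun_eq_iff PiE_def extensional_def)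
    show "?i q \<in> retractions P G"
      using q retractions_map_iso[OF _ P G g f e', of \<phi> \<pi>] by simp
  qed
qed

lemma pattern_count_self_pos:
  assumes P: "simple_graph P"
  shows "pattern_count P P > 0"
proof -
  let ?id = "restrict id (verts P)"
  have fP: "finite (verts P)" using P by (simp add: simple_graph_def)
  have q: "(?id, ?id) \<in> retractions P P"
    by (rule retractionsI) (use simple_graph_edgeD[OF P] in auto)
  have "{x \<in> verts P. ?id x = u} = {u}" if "u \<in> verts P" for u using that by auto
  then have "fibre_weight P P ?id > 0" by (auto simp: fibre_weight_def intro!: prod_pos)
  then have "0 < fibre_weight P P (snd (?id, ?id))" by simp
  then show ?thesis
    unfolding pattern_count_def
    by (intro sum_pos2[OF finite_retractions[OF fP fP] q]) (auto intro: fibre_weight_nonneg)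
qed

text \<open>With equally many vertices the injective map \<open>\<phi>\<close> is onto, and the edge
  condition of a retraction makes it an isomorphism.\<close>

lemma pattern_count_eq_0:
  assumes "simple_graph G" "card (verts P) = card (verts G)" "simple_graph P" "\<not> graph_iso P G"
  shows "pattern_count P G = 0"
proof -
  have False if q: "(\<phi>, \<pi>) \<in> retractions P G" for \<phi> \<pi>
  proof -
    note r = retractionsD[OF q]
    have inj: "inj_on \<phi> (verts P)" by (rule inj_on_inverseI[of _ \<pi>]) (rule r(3))
    have "\<phi> ` verts P = verts G"
      using assms(1,2) r(1) card_image[OF inj]
      by (intro card_subset_eq) (auto simp: simple_graph_def)
    then have bij: "bij_betw \<phi> (verts P) (verts G)" using inj by (simp add: bij_betw_def)
    have "{u, v} \<in> edges P" if "u \<in> verts P" "v \<in> verts P" "{\<phi> u, \<phi> v} \<in> edges G" for u v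
      using r(5)[OF that(3)] r(3) that simple_graph_edgeD(3)[OF assms(1) that(3)] by auto
    then have "graph_iso P G" unfolding graph_iso_def using bij r(4) by blast
    with assms(4) show False by simp
  qed
  then have "retractions P G = {}" by (metis all_not_in_conv surj_pair)
  then show ?thesis by (simp add: pattern_count_def)
qed

section \<open>Bounding pattern counts by common ancestors\<close>

text \<open>For \<open>x\<close> and \<open>r\<close> in a connected \<open>G\<close>: the vertices that every walk from \<open>x\<close> to \<open>r\<close> visits.\<close>

definition ancestors :: "ugraph \<Rightarrow> nat \<Rightarrow> nat \<Rightarrow> nat set" where
  "ancestors G r x = {a \<in> verts G. a = r \<or>
     (x, r) \<notin> {(b, c). {b, c} \<in> edges G \<and> b \<noteq> a \<and> c \<noteq> a}\<^sup>*}"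

text \<open>A walk can leave the fibre of \<open>x\<close> only through the point
  \<open>\<phi> (\<pi> x)\<close> of the copy, and a walk to \<open>r\<close> has to leave
  it.\<close>

lemma fibre_ancestor:
  assumes q: "(\<phi>, \<pi>) \<in> retractions P G" and x: "x \<in> verts G" and ne: "\<pi> x \<noteq> \<pi> r"
  shows "\<phi> (\<pi> x) \<in> ancestors G r x"
proof (rule ccontr)
  note r = retractionsD[OF q]
  let ?a = "\<phi> (\<pi> x)"
  assume "\<not> ?thesis"
  moreover have "?a \<in> verts G" using r(1,2) x by auto
  ultimately have "(x, r) \<in> {(b, c). {b, c} \<in> edges G \<and> b \<noteq> ?a \<and> c \<noteq> ?a}\<^sup>*"
    by (auto simp: ancestors_def)
  then have "\<pi> r = \<pi> x"
  proof (induction rule: rtrancl_induct)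
    case (step b c)
    then have "{b, c} \<in> edges G" "b \<noteq> ?a" by auto
    with r(5)[OF this(1)] step.IH show ?case by metis
  qed simp
  with ne show False by simp
qed

text \<open>Fibres are connected: a walk from \<open>\<phi> u\<close> can leave and reenter the
  fibre of \<open>u\<close> only at \<open>\<phi> u\<close>, so its excursions can be
  ignored.\<close>

lemma fibre_induct:
  assumes q: "(\<phi>, \<pi>) \<in> retractions P G" and G: "connected_graph G"
    and s: "s \<in> verts G" "\<pi> s = u" and x: "x \<in> verts G" "\<pi> x = u" and Q: "Q s"
    and step: "\<And>a b. {a, b} \<in> edges G \<Longrightarrow> \<pi> a = u \<Longrightarrow> \<pi> b = u \<Longrightarrow> Q a \<Longrightarrow> Q b"
  shows "Q x"
proof -
  note r = retractionsD[OF q]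
  have u: "u \<in> verts P" using r(2) s by auto
  then have \<phi>u: "\<phi> u \<in> verts G" using r(1) by auto
  have *: "R y" if "R (\<phi> u)" "y \<in> verts G" "\<pi> y = u"
    "\<And>a b. {a, b} \<in> edges G \<Longrightarrow> \<pi> a = u \<Longrightarrow> \<pi> b = u \<Longrightarrow> R a \<Longrightarrow> R b" for R y
  proof -
    have "\<pi> y = u \<longrightarrow> R y"
    proof (rule connected_graph_induct[OF G \<phi>u that(2)])
      fix a b assume ab: "{a, b} \<in> edges G" "\<pi> a = u \<longrightarrow> R a"
      show "\<pi> b = u \<longrightarrow> R b"
        using that(4)[OF ab(1)] r(5)[OF ab(1)] ab(2) that(1) by metis
    qed (use that in simp)
    with that show ?thesis by simp
  qed
  \<comment> \<open>Contraposition replaces the reversed walk from \<open>s\<close> to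
    \<open>\<phi> u\<close>: a failure of \<open>Q\<close> at \<open>\<phi> u\<close> would spread
    to \<open>s\<close>.\<close>
  have "Q (\<phi> u)"
  proof (rule ccontr)
    assume n: "\<not> Q (\<phi> u)"
    have "\<not> Q s"
      by (rule *[of "\<lambda>y. \<not> Q y"]) (use n s step in \<open>auto simp: insert_commute\<close>)
    with Q show False by simp
  qed
  then show ?thesis by (rule *) (use x step in auto)
qed

text \<open>
  The value \<open>\<phi> (\<pi> r)\<close> need not be recorded: this saves a factor \<open>n\<close> in \<open>pattern_count_le\<close>.
\<close>

lemma retraction_determined:
  assumes q: "(\<phi>, \<pi>) \<in> retractions P G" and q': "(\<phi>', \<pi>') \<in> retractions P G"
    and P: "simple_graph P" "connected_graph P" "card (verts P) \<ge> 2"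
    and G: "connected_graph G" and rG: "r \<in> verts G" and u0: "\<pi> r = u0" "\<pi>' r = u0"
    and eq: "\<And>u. u \<in> verts P \<Longrightarrow> u \<noteq> u0 \<Longrightarrow> \<phi> u = \<phi>' u"
  shows "\<phi> = \<phi>' \<and> \<pi> = \<pi>'"
proof -
  have in_P: "\<pi> x \<in> verts P" if "x \<in> verts G" "(\<phi>, \<pi>) \<in> retractions P G" for \<phi> \<pi> x
    using retractionsD(2)[OF that(2)] that(1) by auto
  \<comment> \<open>If an edge inside the fibre of \<open>u0\<close> under \<open>\<pi>\<close> left
    the one under \<open>\<pi>'\<close>, it would end at a point \<open>\<phi>' u\<close> with
    \<open>u \<noteq> u0\<close>, where the two copies agree. The retractions are quantified afresh
    so that they can exchange roles.\<close>
  have base: "\<pi>' x = u0"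
    if q: "(\<phi>, \<pi>) \<in> retractions P G" and q': "(\<phi>', \<pi>') \<in> retractions P G"
      and u0: "\<pi> r = u0" "\<pi>' r = u0" and eq: "\<And>u. u \<in> verts P \<Longrightarrow> u \<noteq> u0 \<Longrightarrow> \<phi> u = \<phi>' u"
      and x: "x \<in> verts G" "\<pi> x = u0" for \<phi> \<pi> \<phi>' \<pi>' x
  proof (rule fibre_induct[OF q G rG u0(1) x, of "\<lambda>x. \<pi>' x = u0"])
    fix a b assume ab: "{a, b} \<in> edges G" "\<pi> a = u0" "\<pi> b = u0" "\<pi>' a = u0"
    show "\<pi>' b = u0"
    proof (rule ccontr)
      assume n: "\<pi>' b \<noteq> u0"
      then have *: "\<phi>' (\<pi>' b) = b" "{\<pi>' a, \<pi>' b} \<in> edges P" using retractionsD(5)[OF q' ab(1)] ab by auto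
      have "\<pi>' b \<in> verts P" using simple_graph_edgeD[OF P(1) *(2)] by simp
      then have "\<pi> b = \<pi>' b" using eq n *(1) retractionsD(3)[OF q] by metis
      with n ab show False by simp
    qed
  qed (use u0 in simp)
  have base_iff: "\<pi> x = u0 \<longleftrightarrow> \<pi>' x = u0" if "x \<in> verts G" for x
    using base[OF q q' u0 eq that] base[OF q' q u0(2,1) eq[symmetric] that] by blast
  have \<pi>: "\<pi> x = \<pi>' x" if x: "x \<in> verts G" for x
  proof (cases "\<pi> x = u0")
    case True
    then show ?thesis using base_iff[OF x] by simp
  next
    case False
    define u where "u = \<pi> x"
    have u: "u \<in> verts P" "u \<noteq> u0" using in_P[OF x q] False by (auto simp: u_def)
    have \<phi>u: "\<phi> u \<in> verts G" "\<pi> (\<phi> u) = u" using retractionsD(1,3)[OF q] u by auto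
    have "\<pi>' x = u"
    proof (rule fibre_induct[OF q G \<phi>u x])
      show "\<pi> x = u" by (simp add: u_def)
      show "\<pi>' (\<phi> u) = u" using eq[OF u] retractionsD(3)[OF q' u(1)] by simp
      fix a b assume ab: "{a, b} \<in> edges G" "\<pi> a = u" "\<pi> b = u" "\<pi>' a = u"
      show "\<pi>' b = u"
      proof (rule ccontr)
        assume n: "\<pi>' b \<noteq> u"
        then have *: "\<phi>' (\<pi>' b) = b" "{\<pi>' a, \<pi>' b} \<in> edges P"
          using retractionsD(5)[OF q' ab(1)] ab by auto
        have bP: "\<pi>' b \<in> verts P" using simple_graph_edgeD[OF P(1) *(2)] by simp
        then have bG: "b \<in> verts G" using *(1) retractionsD(1)[OF q'] by (metis PiE_mem)
        show False
        proof (cases "\<pi>' b = u0")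
          case True
          then show ?thesis using base_iff[OF bG] ab u by simp
        next
          case False
          then have "\<pi> b = \<pi>' b" using eq *(1) bP retractionsD(3)[OF q] by metis
          with n ab show False by simp
        qed
      qed
    qed
    then show ?thesis by (simp add: u_def)
  qed
  have "\<pi> = \<pi>'" using retractionsD(2)[OF q] retractionsD(2)[OF q'] \<pi> by (rule PiE_ext)
  \<comment> \<open>The image under \<open>\<phi>\<close> of an edge at \<open>u\<close> joins
    different fibres of \<open>\<pi>'\<close>, so its end in the fibre of \<open>u\<close> is also
    \<open>\<phi>' u\<close>. This recovers the unrecorded value at \<open>u0\<close>.\<close>
  moreover have "\<phi> u = \<phi>' u" if u: "u \<in> verts P" for u
  proof -
    obtain u' where u': "{u, u'} \<in> edges P" using connected_graph_has_neighbour[OF P(2) u P(3)] ..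
    have ne: "u' \<noteq> u" "u' \<in> verts P" using simple_graph_edgeD[OF P(1) u'] by auto
    have e: "{\<phi> u, \<phi> u'} \<in> edges G" using retractionsD(4)[OF q u'] .
    have "\<pi> (\<phi> u) = u" "\<pi> (\<phi> u') = u'" using retractionsD(3)[OF q] u ne by auto
    then show ?thesis using retractionsD(5)[OF q' e] ne \<open>\<pi> = \<pi>'\<close> by simp
  qed
  then have "\<phi> = \<phi>'" by (intro PiE_ext[OF retractionsD(1)[OF q] retractionsD(1)[OF q']]) auto
  ultimately show ?thesis by simp
qed

text \<open>Double counting of the triples \<open>(a, x, y)\<close> with \<open>a\<close> in both
  \<open>A x\<close> and \<open>A y\<close>.\<close>

lemma sum_descendants_squared:
  assumes "finite V" "\<And>x. x \<in> V \<Longrightarrow> A x \<subseteq> V"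
  shows "(\<Sum>a\<in>V. (real (card {x \<in> V. a \<in> A x}))\<^sup>2) = (\<Sum>x\<in>V. \<Sum>y\<in>V. real (card (A x \<inter> A y)))"
proof -
  have card_of_bool: "real (card {x \<in> V. Q x}) = (\<Sum>x\<in>V. of_bool (Q x))" for Q
    using assms(1) by (simp add: Int_def)
  have 1: "real (card {x \<in> V. a \<in> A x}) = (\<Sum>x\<in>V. of_bool (a \<in> A x))" for a
    by (rule card_of_bool)
  have 2: "real (card (A x \<inter> A y)) = (\<Sum>a\<in>V. of_bool (a \<in> A x) * of_bool (a \<in> A y))" if "x \<in> V" for x y
  proof -
    have "A x \<inter> A y = {a \<in> V. a \<in> A x \<and> a \<in> A y}" using assms(2)[OF that] by auto
    moreover have "(\<Sum>a\<in>V. of_bool (a \<in> A x) * of_bool (a \<in> A y)) =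
        (\<Sum>a\<in>V. of_bool (a \<in> A x \<and> a \<in> A y) :: real)" by (intro sum.cong) (auto simp del: of_bool_eq_iff)
    ultimately show ?thesis by (simp only: card_of_bool)
  qed
  have "(\<Sum>a\<in>V. (real (card {x \<in> V. a \<in> A x}))\<^sup>2) =
      (\<Sum>a\<in>V. \<Sum>x\<in>V. \<Sum>y\<in>V. of_bool (a \<in> A x) * of_bool (a \<in> A y))"
    by (simp only: 1 power2_eq_square sum_product)
  also have "\<dots> = (\<Sum>x\<in>V. \<Sum>a\<in>V. \<Sum>y\<in>V. of_bool (a \<in> A x) * of_bool (a \<in> A y))"
    by (rule sum.swap)
  also have "\<dots> = (\<Sum>x\<in>V. \<Sum>y\<in>V. \<Sum>a\<in>V. of_bool (a \<in> A x) * of_bool (a \<in> A y))"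
    by (intro sum.cong refl sum.swap)
  also have "\<dots> = (\<Sum>x\<in>V. \<Sum>y\<in>V. real (card (A x \<inter> A y)))"
    by (intro sum.cong refl) (simp only: 2)
  finally show ?thesis .
qed

text \<open>By \<open>sum_descendants_squared\<close> this is also the sum of the squared subtree
  sizes of the tree rooted at \<open>r\<close>.\<close>

definition common_ancestors :: "ugraph \<Rightarrow> nat \<Rightarrow> real" where
  "common_ancestors G r = (\<Sum>x\<in>verts G. \<Sum>y\<in>verts G. real (card (ancestors G r x \<inter> ancestors G r y)))"

text \<open>The fibre containing \<open>r\<close> is bounded by \<open>n\<close>, any other fibre by
  the number of descendants of its point in the copy. Enlarging the sum to all maps of the other
  \<open>m - 1\<close> vertices makes it factorise; the factor \<open>m\<close> counts the choices
  of the fibre of \<open>r\<close>, and \<open>2 ^ m\<close> comes from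
  \<open>c + 1 \<le> 2 * c\<close>.\<close>

lemma pattern_count_le:
  assumes P: "simple_graph P" "connected_graph P" "card (verts P) \<ge> 2"
    and G: "simple_graph G" "connected_graph G" and rG: "r \<in> verts G"
  shows "pattern_count P G \<le> 2 ^ card (verts P) * real (card (verts P)) *
    (real (card (verts G)))\<^sup>2 * common_ancestors G r ^ (card (verts P) - 1)"
proof -
  define m where "m = card (verts P)"
  define n where "n = card (verts G)"
  define N where "N a = real (card {x \<in> verts G. a \<in> ancestors G r x})" for a
  have fP: "finite (verts P)" and fG: "finite (verts G)" using P G by (auto simp: simple_graph_def)
  define f where "f p = (\<Prod>u\<in>verts P - {fst p}. (N (snd p u))\<^sup>2)" for p :: "nat \<times> (nat \<Rightarrow> nat)"
  define D where "D = (SIGMA u0:verts P. (verts P - {u0}) \<rightarrow>\<^sub>E verts G)"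
  \<comment> \<open>The code of a retraction: the index of the fibre of \<open>r\<close> and the
    copy without the point of that fibre. It is injective by
    \<open>retraction_determined\<close>.\<close>
  define i where "i q = (snd q r, restrict (fst q) (verts P - {snd q r}))"
    for q :: "(nat \<Rightarrow> nat) \<times> (nat \<Rightarrow> nat)"
  have fin: "finite D" unfolding D_def using fP fG by (auto intro!: finite_SigmaI finite_PiE)
  have wt: "fibre_weight P G (snd q) \<le> 2 ^ m * (real n)\<^sup>2 * f (i q)" if q: "q \<in> retractions P G" for q
  proof -
    obtain \<phi> \<pi> where q': "q = (\<phi>, \<pi>)" by (cases q)
    have q2: "(\<phi>, \<pi>) \<in> retractions P G" using q q' by simp
    note r = retractionsD[OF q2]
    define c where "c u = real (card {x \<in> verts G. \<pi> x = u})" for u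
    have c1: "c u \<ge> 1" if "u \<in> verts P" for u
    proof -
      have "\<phi> u \<in> {x \<in> verts G. \<pi> x = u}" using r(1,3) that by auto
      then have "card {x \<in> verts G. \<pi> x = u} > 0" using fG by (auto simp: card_gt_0_iff)
      then show ?thesis by (simp add: c_def)
    qed
    have cn: "c u \<le> real n" for u unfolding c_def n_def using fG by (auto intro!: card_mono)
    have cN: "c u \<le> N (\<phi> u)" if "u \<noteq> \<pi> r" for u
    proof -
      have "{x \<in> verts G. \<pi> x = u} \<subseteq> {x \<in> verts G. \<phi> u \<in> ancestors G r x}"
        using fibre_ancestor[OF q2] that by auto
      then show ?thesis unfolding c_def N_def using fG by (auto intro!: card_mono)
    qed
    have \<pi>r: "\<pi> r \<in> verts P" using r(2) rG by auto
    have "fibre_weight P G \<pi> = (\<Prod>u\<in>verts P. c u * (c u + 1))"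
      by (simp add: fibre_weight_def c_def)
    also have "\<dots> \<le> (\<Prod>u\<in>verts P. 2 * (c u)\<^sup>2)"
    proof (rule prod_mono)
      fix u assume "u \<in> verts P"
      then have "c u \<ge> 1" by (rule c1)
      then have "c u * (c u + 1) \<le> c u * (c u + c u)" by (intro mult_left_mono) auto
      then show "0 \<le> c u * (c u + 1) \<and> c u * (c u + 1) \<le> 2 * (c u)\<^sup>2"
        using \<open>c u \<ge> 1\<close> by (simp add: power2_eq_square)
    qed
    also have "\<dots> = 2 ^ m * ((c (\<pi> r))\<^sup>2 * (\<Prod>u\<in>verts P - {\<pi> r}. (c u)\<^sup>2))"
      using prod.remove[OF fP \<pi>r, of "\<lambda>u. (c u)\<^sup>2"] by (simp add: prod.distrib m_def)
    also have "\<dots> \<le> 2 ^ m * ((real n)\<^sup>2 * (\<Prod>u\<in>verts P - {\<pi> r}. (N (\<phi> u))\<^sup>2))"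
    proof (intro mult_left_mono mult_mono prod_mono power_mono cn)
      show "0 \<le> c (\<pi> r)" by (simp add: c_def)
      show "0 \<le> (\<Prod>u\<in>verts P - {\<pi> r}. (c u)\<^sup>2)" by (intro prod_nonneg) auto
      show "0 \<le> (c u)\<^sup>2 \<and> (c u)\<^sup>2 \<le> (N (\<phi> u))\<^sup>2" if "u \<in> verts P - {\<pi> r}" for u
        using cN[of u] that c1[of u] by (auto intro!: power_mono)
    qed auto
    also have "(\<Prod>u\<in>verts P - {\<pi> r}. (N (\<phi> u))\<^sup>2) = f (i q)"
      by (auto simp: f_def i_def q' intro!: prod.cong)
    finally show ?thesis by (simp add: q' mult.assoc)
  qed
  have inj: "inj_on i (retractions P G)"
  proof (rule inj_onI)
    fix q q' assume h: "q \<in> retractions P G" "q' \<in> retractions P G" "i q = i q'"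
    obtain \<phi> \<pi> \<phi>' \<pi>' where qs: "q = (\<phi>, \<pi>)" "q' = (\<phi>', \<pi>')" by (cases q; cases q')
    have e: "\<pi> r = \<pi>' r" "restrict \<phi> (verts P - {\<pi> r}) = restrict \<phi>' (verts P - {\<pi> r})"
      using h(3) by (auto simp: i_def qs)
    have "\<phi> u = \<phi>' u" if "u \<in> verts P" "u \<noteq> \<pi> r" for u
      using fun_cong[OF e(2), of u] that by simp
    then show "q = q'"
      using retraction_determined[OF h(1)[unfolded qs] h(2)[unfolded qs] P G(2) rG refl e(1)[symmetric]] qs
      by simp
  qed
  have sub: "i ` retractions P G \<subseteq> D"
  proof
    fix p assume "p \<in> i ` retractions P G"
    then obtain \<phi> \<pi> where q: "(\<phi>, \<pi>) \<in> retractions P G" "p = i (\<phi>, \<pi>)" by auto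
    have "\<pi> r \<in> verts P" using retractionsD(2)[OF q(1)] rG by auto
    moreover have "restrict \<phi> (verts P - {\<pi> r}) \<in> (verts P - {\<pi> r}) \<rightarrow>\<^sub>E verts G"
      using retractionsD(1)[OF q(1)] by auto
    ultimately show "p \<in> D" by (simp add: q(2) i_def D_def)
  qed
  have "pattern_count P G \<le> (\<Sum>q\<in>retractions P G. 2 ^ m * (real n)\<^sup>2 * f (i q))"
    unfolding pattern_count_def by (intro sum_mono wt)
  also have "\<dots> = 2 ^ m * (real n)\<^sup>2 * (\<Sum>p\<in>i ` retractions P G. f p)"
    by (simp add: sum_distrib_left sum.reindex[OF inj])
  also have "\<dots> \<le> 2 ^ m * (real n)\<^sup>2 * (\<Sum>p\<in>D. f p)"
    by (intro mult_left_mono sum_mono2 fin sub) (auto simp: f_def intro!: prod_nonneg)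
  also have "(\<Sum>p\<in>D. f p) = (\<Sum>u0\<in>verts P. \<Sum>\<psi>\<in>(verts P - {u0}) \<rightarrow>\<^sub>E verts G.
      \<Prod>u\<in>verts P - {u0}. (N (\<psi> u))\<^sup>2)"
    unfolding D_def f_def using fP fG by (subst sum.Sigma) (auto simp: case_prod_unfold intro!: finite_PiE)
  also have "\<dots> = (\<Sum>u0\<in>verts P. \<Prod>u\<in>verts P - {u0}. \<Sum>a\<in>verts G. (N a)\<^sup>2)"
    using fP fG by (intro sum.cong refl prod_sum_PiE[symmetric]) auto
  also have "\<dots> = (\<Sum>u0\<in>verts P. (\<Sum>a\<in>verts G. (N a)\<^sup>2) ^ (m - 1))"
    using fP by (intro sum.cong) (auto simp: m_def)
  also have "(\<Sum>a\<in>verts G. (N a)\<^sup>2) = common_ancestors G r"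
    unfolding N_def common_ancestors_def
    by (rule sum_descendants_squared[OF fG]) (auto simp: ancestors_def)
  finally show ?thesis by (simp add: m_def n_def mult_ac)
qed

section \<open>Growth of ancestor sets and of the potential\<close>

context leaf_extension
begin

text \<open>Visits to the leaf \<open>w\<close> can be cut out of a walk, reading \<open>w\<close>
  as \<open>v\<close>; and \<open>w\<close> is no ancestor of an old vertex, because
  \<open>G\<close> contains a walk without it.\<close>

lemma ancestors_old:
  assumes cG: "connected_graph G" and r: "r \<in> verts G" and x: "x \<in> verts G"
  shows "ancestors G' r x = ancestors G r x"
proof -
  define R where "R a = {(b, c). {b, c} \<in> edges G \<and> b \<noteq> a \<and> c \<noteq> a}" for a
  define R' where "R' a = {(b, c). {b, c} \<in> edges G' \<and> b \<noteq> a \<and> c \<noteq> a}" for a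
  have sub: "R a \<subseteq> R' a" for a by (auto simp: R_def R'_def E)
  have "(x, r) \<in> (R a)\<^sup>*" if "(x, r) \<in> (R' a)\<^sup>*" for a
  proof -
    have "(x, if r = w then v else r) \<in> (R a)\<^sup>*"
      using that
    proof (induction rule: rtrancl_induct)
      case base
      then show ?case using x w by auto
    next
      case (step b c)
      from step.hyps(2) consider "b = w" "c = v" | "b = v" "c = w" | "{b, c} \<in> edges G" "(b, c) \<in> R a"
        by (auto simp: R'_def R_def edge_extension_iff)
      then show ?case
      proof cases
        case 3
        then show ?thesis using edge_vertices[OF 3(1)] step.IH by (auto intro: rtrancl_into_rtrancl)
      qed (use step.IH v w in auto)
    qed
    then show ?thesis using r w by (auto split: if_splits)
  qed
  moreover have "(x, r) \<in> (R' a)\<^sup>*" if "(x, r) \<in> (R a)\<^sup>*" for a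
    using that rtrancl_mono[OF sub] by blast
  ultimately have eq: "(x, r) \<in> (R' a)\<^sup>* \<longleftrightarrow> (x, r) \<in> (R a)\<^sup>*" for a by blast
  have "(x, r) \<in> (R' w)\<^sup>*"
  proof (rule connected_graph_induct[OF cG x r])
    fix a b assume ab: "{a, b} \<in> edges G" "(x, a) \<in> (R' w)\<^sup>*"
    then have "(a, b) \<in> R' w" using edge_vertices[OF ab(1)] by (auto simp: R'_def E)
    with ab(2) show "(x, b) \<in> (R' w)\<^sup>*" by (rule rtrancl_into_rtrancl)
  qed simp
  then show ?thesis
    using r w eq unfolding ancestors_def R_def R'_def V by auto
qed

text \<open>Every walk from \<open>w\<close> to \<open>r\<close> begins with the step to
  \<open>v\<close>.\<close>

lemma ancestors_new:
  assumes cG: "connected_graph G" and r: "r \<in> verts G"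
  shows "ancestors G' r w = insert w (ancestors G r v)"
proof -
  define R' where "R' a = {(b, c). {b, c} \<in> edges G' \<and> b \<noteq> a \<and> c \<noteq> a}" for a
  have first: "w \<noteq> a \<and> v \<noteq> a" if "(w, r) \<in> (R' a)\<^sup>*" for a
    using that
  proof (cases rule: converse_rtranclE)
    case base
    then show ?thesis using r w by simp
  next
    case (step y)
    then have "{w, y} \<in> edges G'" "w \<noteq> a" "y \<noteq> a" by (auto simp: R'_def)
    then show ?thesis using edge_vertices[of w y] v w by (auto simp: edge_extension_iff)
  qed
  have "(w, v) \<in> R' a" "(v, w) \<in> R' a" if "a \<noteq> v" "a \<noteq> w" for a
    using that by (auto simp: R'_def edge_extension_iff)
  then have iff: "(w, r) \<in> (R' a)\<^sup>* \<longleftrightarrow> (v, r) \<in> (R' a)\<^sup>*" if "a \<noteq> v" "a \<noteq> w" for a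
    using that by (meson converse_rtrancl_into_rtrancl)
  have v_r: "v = r \<or> (v, r) \<notin> (R' v)\<^sup>*"
  proof (rule ccontr)
    assume "\<not> ?thesis"
    then obtain y where "(v, y) \<in> R' v" by (metis converse_rtranclE)
    then show False by (auto simp: R'_def)
  qed
  have "a \<in> ancestors G' r w \<longleftrightarrow> a \<in> insert w (ancestors G' r v)" for a
    using first[of a] iff[of a] v_r v
    unfolding ancestors_def R'_def[symmetric] V by auto
  then have "ancestors G' r w = insert w (ancestors G' r v)" by blast
  then show ?thesis using ancestors_old[OF cG r v] by simp
qed

end

text \<open>
  The base \<open>3 / 2\<close> could be any number in \<open>(1, 2)\<close>; the coefficient \<open>3\<close> is then forced by the
  exact recursion \<open>sum_potential_attach\<close>.
\<close>

definition potential :: "ugraph \<Rightarrow> nat \<Rightarrow> real" where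
  "potential G r =
     (\<Sum>x\<in>verts G. \<Sum>y\<in>verts G. (3 / 2) ^ card (ancestors G r x \<inter> ancestors G r y)) +
     3 * (\<Sum>x\<in>verts G. (3 / 2) ^ card (ancestors G r x))"

lemma potential_nonneg: "potential G r \<ge> 0"
  unfolding potential_def by (intro add_nonneg_nonneg mult_nonneg_nonneg sum_nonneg) auto

text \<open>The new vertex shares with an old \<open>x\<close> what \<open>v\<close> shares with
  \<open>x\<close>, and has one ancestor more than \<open>v\<close>. Let \<open>R\<close> and
  \<open>s\<close> be the double and the single sum and \<open>z = 3 / 2\<close>. Summing over
  \<open>v\<close> turns \<open>R\<close> into \<open>(n + 2) * R + z * s\<close> and
  \<open>s\<close> into \<open>(n + z) * s\<close>, so \<open>R + k * s\<close> gains the factor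
  \<open>n + 2\<close> when \<open>z + k * z = 2 * k\<close>, that is \<open>k = 3\<close>.\<close>

lemma sum_potential_attach:
  assumes G: "simple_graph G" and cG: "connected_graph G" and r: "r \<in> verts G"
  shows "(\<Sum>v\<in>verts G. potential (attach G v) r) = (real (card (verts G)) + 2) * potential G r"
proof -
  let ?V = "verts G"
  define A where "A = ancestors G r"
  define z :: real where "z = 3 / 2"
  define s where "s = (\<Sum>x\<in>?V. z ^ card (A x))"
  define R where "R = (\<Sum>x\<in>?V. \<Sum>y\<in>?V. z ^ card (A x \<inter> A y))"
  have fin: "finite ?V" using G by (simp add: simple_graph_def)
  have AV: "A x \<subseteq> ?V" for x by (auto simp: A_def ancestors_def)
  have w: "fresh G \<notin> ?V" using fresh_notin[OF fin] .
  have finA: "finite (A x)" for x using AV fin by (rule finite_subset)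
  have wA: "fresh G \<notin> A x" for x using AV w by blast
  have "potential (attach G v) r = R + 2 * (\<Sum>x\<in>?V. z ^ card (A x \<inter> A v)) + z * z ^ card (A v)
      + 3 * (s + z * z ^ card (A v))" if v: "v \<in> ?V" for v
  proof -
    interpret leaf_extension G "attach G v" "fresh G" v using leaf_extension_attach[OF G v] .
    have old: "ancestors (attach G v) r x = A x" if "x \<in> ?V" for x
      using ancestors_old[OF cG r that] by (simp add: A_def)
    have new: "ancestors (attach G v) r (fresh G) = insert (fresh G) (A v)"
      using ancestors_new[OF cG r] by (simp add: A_def)
    have i: "insert (fresh G) (A v) \<inter> A x = A x \<inter> A v" "A x \<inter> insert (fresh G) (A v) = A x \<inter> A v" for x
      using wA by auto
    have 1: "(\<Sum>x\<in>verts (attach G v). z ^ card (ancestors (attach G v) r x)) = s + z * z ^ card (A v)"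
      using fin w wA finA by (simp add: new old s_def)
    have "(\<Sum>x\<in>verts (attach G v). \<Sum>y\<in>verts (attach G v).
        z ^ card (ancestors (attach G v) r x \<inter> ancestors (attach G v) r y)) =
        z ^ card (insert (fresh G) (A v)) + (\<Sum>y\<in>?V. z ^ card (A y \<inter> A v)) +
        (\<Sum>x\<in>?V. z ^ card (A x \<inter> A v) + (\<Sum>y\<in>?V. z ^ card (A x \<inter> A y)))"
      using fin w by (simp add: new old i)
    also have "\<dots> = R + 2 * (\<Sum>x\<in>?V. z ^ card (A x \<inter> A v)) + z * z ^ card (A v)"
      using wA finA by (simp add: R_def sum.distrib)
    finally show ?thesis using 1 by (simp add: potential_def z_def)
  qed
  then have "(\<Sum>v\<in>?V. potential (attach G v) r) =
      (\<Sum>v\<in>?V. R + 2 * (\<Sum>x\<in>?V. z ^ card (A x \<inter> A v)) + z * z ^ card (A v)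
        + 3 * (s + z * z ^ card (A v)))" by (intro sum.cong) auto
  also have "\<dots> = card ?V * R + 2 * (\<Sum>v\<in>?V. \<Sum>x\<in>?V. z ^ card (A x \<inter> A v)) + z * s
      + 3 * (card ?V * s + z * s)"
    by (simp add: sum.distrib s_def flip: sum_distrib_left)
  also have "(\<Sum>v\<in>?V. \<Sum>x\<in>?V. z ^ card (A x \<inter> A v)) = R"
    unfolding R_def by (rule sum.swap)
  also have "real (card ?V) * R + 2 * R + z * s + 3 * (real (card ?V) * s + z * s) =
      (real (card ?V) + 2) * (R + 3 * s)"
    by (simp add: z_def algebra_simps)
  also have "R + 3 * s = potential G r" by (simp add: potential_def R_def s_def z_def A_def)
  finally show ?thesis .
qed

section \<open>Moments of the normalised number of common ancestors\<close>

lemma power_le_exp: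
  fixes c :: real
  assumes "c > 0"
  shows "\<exists>C\<ge>0. \<forall>t\<ge>0. t ^ p \<le> C * exp (c * t)"
proof (cases "p = 0")
  case True
  then show ?thesis using assms by (intro exI[of _ 1]) auto
next
  case False
  have "t ^ p \<le> (real p / c) ^ p * exp (c * t)" if t: "t \<ge> 0" for t
  proof -
    have "(c * t / real p) ^ p \<le> (1 + c * t / real p) ^ p"
      using assms t by (intro power_mono) auto
    also have "\<dots> \<le> exp (c * t)"
      using assms t False by (intro exp_ge_one_plus_x_over_n_power_n) (auto intro: order_trans[of _ 0])
    finally have "(real p / c) ^ p * (c * t / real p) ^ p \<le> (real p / c) ^ p * exp (c * t)"
      using assms by (intro mult_left_mono) auto
    then show ?thesis using assms False by (simp flip: power_mult_distrib)
  qed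
  then show ?thesis using assms by (intro exI[of _ "(real p / c) ^ p"]) auto
qed

text \<open>Jensen's inequality for \<open>exp\<close>, obtained from the tangent at the mean
  \<open>a\<close>.\<close>

lemma exp_mean_le:
  fixes f :: "'a \<Rightarrow> real"
  assumes "finite X"
  shows "real (card X) * exp ((\<Sum>x\<in>X. f x) / real (card X)) \<le> (\<Sum>x\<in>X. exp (f x))"
proof (cases "X = {}")
  case False
  define a where "a = (\<Sum>x\<in>X. f x) / real (card X)"
  have s: "(\<Sum>x\<in>X. f x) = a * real (card X)" using assms False by (simp add: a_def)
  have "exp a * (1 + (f x - a)) \<le> exp (f x)" for x
    using mult_left_mono[OF exp_ge_add_one_self[of "f x - a"], of "exp a"] by (simp flip: exp_add)
  then have "(\<Sum>x\<in>X. exp a * (1 + (f x - a))) \<le> (\<Sum>x\<in>X. exp (f x))" by (intro sum_mono)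
  also have "(\<Sum>x\<in>X. exp a * (1 + (f x - a))) = exp a * real (card X)"
    by (simp add: sum.distrib sum_subtractf s flip: sum_distrib_left)
  finally show ?thesis by (simp add: a_def mult.commute)
qed simp

text \<open>The power is bounded by an exponential with rate \<open>c = ln (3 / 2)\<close>; Jensen
  then passes from the mean over pairs to the mean of \<open>(3 / 2) ^ k\<close>, which is part of
  the potential.\<close>

lemma common_ancestors_power_le:
  "\<exists>C\<ge>0. \<forall>G r. finite (verts G) \<longrightarrow> verts G \<noteq> {} \<longrightarrow>
     (common_ancestors G r / (real (card (verts G)))\<^sup>2) ^ p \<le> C * (potential G r / (real (card (verts G)))\<^sup>2)"
proof -
  define c :: real where "c = ln (3 / 2)"
  have c: "c > 0" by (simp add: c_def)
  have ec: "exp (c * real k) = (3 / 2) ^ k" for k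
    using exp_of_nat_mult[of k c] by (simp add: c_def mult.commute)
  obtain C where C: "C \<ge> 0" "\<And>t. t \<ge> 0 \<Longrightarrow> t ^ p \<le> C * exp (c * t)" using power_le_exp[OF c] by blast
  have "(common_ancestors G r / (real (card (verts G)))\<^sup>2) ^ p \<le>
      C * (potential G r / (real (card (verts G)))\<^sup>2)"
    if fin: "finite (verts G)" and ne: "verts G \<noteq> {}" for G r
  proof -
    let ?V = "verts G"
    define Q where "Q = common_ancestors G r"
    define N where "N = (real (card ?V))\<^sup>2"
    define h where "h p = real (card (ancestors G r (fst p) \<inter> ancestors G r (snd p)))" for p
    have N: "N > 0" "N = real (card (?V \<times> ?V))"
      using fin ne by (auto simp: N_def power2_eq_square card_gt_0_iff card_cartesian_product)
    have Q: "Q = (\<Sum>p\<in>?V \<times> ?V. h p)"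
      by (simp add: Q_def common_ancestors_def h_def sum.cartesian_product case_prod_unfold)
    have "Q \<ge> 0" unfolding Q by (intro sum_nonneg) (simp add: h_def)
    then have "(Q / N) ^ p \<le> C * exp (c * (Q / N))" using N by (intro C) auto
    also have "c * (Q / N) = (\<Sum>p\<in>?V \<times> ?V. c * h p) / real (card (?V \<times> ?V))"
      unfolding N(2)[symmetric] Q by (simp add: sum_distrib_left)
    also have "exp \<dots> \<le> (\<Sum>p\<in>?V \<times> ?V. exp (c * h p)) / N"
      using exp_mean_le[of "?V \<times> ?V" "\<lambda>p. c * h p"] fin N
      by (simp add: field_simps)
    also have "(\<Sum>p\<in>?V \<times> ?V. exp (c * h p)) \<le> potential G r"
    proof -
      have "(\<Sum>p\<in>?V \<times> ?V. exp (c * h p)) =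
          (\<Sum>x\<in>?V. \<Sum>y\<in>?V. (3 / 2) ^ card (ancestors G r x \<inter> ancestors G r y))"
        by (simp add: h_def ec sum.cartesian_product case_prod_unfold)
      then show ?thesis by (simp add: potential_def sum_nonneg)
    qed
    finally show ?thesis using C(1) N(1) by (simp add: Q_def N_def divide_right_mono mult_left_mono)
  qed
  then show ?thesis using C(1) by blast
qed

text \<open>Writing the number of common ancestors as \<open>n\<^sup>2\<close> times its normalised
  value, the square of \<open>pattern_count_le\<close> collects the exponent
  \<open>4 + 4 * (m - 1) = 4 * m\<close>. The constant is uniform in \<open>G\<close> and
  \<open>r\<close>.\<close>

lemma pattern_count_squared_le:
  assumes P: "simple_graph P" "connected_graph P" "card (verts P) \<ge> 2"
  shows "\<exists>C\<ge>0. \<forall>G r. simple_graph G \<longrightarrow> connected_graph G \<longrightarrow> r \<in> verts G \<longrightarrow>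
    (pattern_count P G)\<^sup>2 \<le> C * real (card (verts G)) ^ (4 * card (verts P)) *
      (potential G r / (real (card (verts G)))\<^sup>2)"
proof -
  define m where "m = card (verts P)"
  obtain C where C: "C \<ge> 0" "\<And>G r. finite (verts G) \<Longrightarrow> verts G \<noteq> {} \<Longrightarrow>
     (common_ancestors G r / (real (card (verts G)))\<^sup>2) ^ (2 * (m - 1)) \<le>
       C * (potential G r / (real (card (verts G)))\<^sup>2)"
    using common_ancestors_power_le by blast
  define K :: real where "K = (2 ^ m * real m)\<^sup>2"
  have "(pattern_count P G)\<^sup>2 \<le> (K * C) * real (card (verts G)) ^ (4 * m) *
      (potential G r / (real (card (verts G)))\<^sup>2)"
    if G: "simple_graph G" "connected_graph G" and r: "r \<in> verts G" for G r
  proof -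
    define n where "n = real (card (verts G))"
    define Q where "Q = common_ancestors G r"
    have fin: "finite (verts G)" "verts G \<noteq> {}" using G r by (auto simp: simple_graph_def)
    have n: "n > 0" using fin by (simp add: n_def card_gt_0_iff)
    have "(pattern_count P G)\<^sup>2 \<le> (2 ^ m * real m * n\<^sup>2 * Q ^ (m - 1))\<^sup>2"
      using pattern_count_le[OF P G r] pattern_count_nonneg
      by (intro power_mono) (auto simp: m_def n_def Q_def)
    also have "\<dots> = K * n ^ 4 * (n\<^sup>2) ^ (2 * (m - 1)) * (Q / n\<^sup>2) ^ (2 * (m - 1))"
      using n by (simp add: K_def power_mult_distrib power_divide power_mult power2_eq_square
          power4_eq_xxxx mult_ac)
    also have "\<dots> \<le> K * n ^ 4 * (n\<^sup>2) ^ (2 * (m - 1)) * (C * (potential G r / n\<^sup>2))"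
      using C(2)[OF fin] n by (intro mult_left_mono) (auto simp: n_def Q_def K_def)
    also have "n ^ 4 * (n\<^sup>2) ^ (2 * (m - 1)) = n ^ (4 * m)"
    proof -
      have "4 * m = 4 + 2 * (2 * (m - 1))" using P(3) by (simp add: m_def)
      then show ?thesis by (simp only: power_add power_mult)
    qed
    then have "K * n ^ 4 * (n\<^sup>2) ^ (2 * (m - 1)) * (C * (potential G r / n\<^sup>2)) =
        K * C * n ^ (4 * m) * (potential G r / n\<^sup>2)" by (simp add: mult_ac)
    finally show ?thesis by (simp add: n_def)
  qed
  moreover have "K * C \<ge> 0" using C(1) by (simp add: K_def)
  ultimately show ?thesis unfolding m_def by blast
qed

section \<open>Distinguishing the attachments of a tree by their degrees\<close>

text \<open>The first vertex of a longest path is a leaf: a second neighbour would prolong the path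
  or, lying on it, close a cycle with an initial segment.\<close>

lemma tree_has_leaf:
  assumes G: "is_tree G" and c: "card (verts G) \<ge> 2"
  shows "leaves G \<noteq> {}"
proof -
  have s: "simple_graph G" and con: "connected_graph G" and acyc: "\<And>c. \<not> graph_cycle G c"
    using G by (auto simp: is_tree_def)
  have fin: "finite (verts G)" using s by (simp add: simple_graph_def)
  define path where "path p \<longleftrightarrow> p \<noteq> [] \<and> distinct p \<and> set p \<subseteq> verts G \<and>
    (\<forall>i. Suc i < length p \<longrightarrow> {p ! i, p ! Suc i} \<in> edges G)" for p
  obtain v where "v \<in> verts G" using con by (auto simp: connected_graph_def)
  then have "path [v]" by (simp add: path_def)
  moreover have "\<forall>p. path p \<longrightarrow> length p < Suc (card (verts G))"
    using fin by (metis path_def card_mono distinct_card less_Suc_eq_le)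
  ultimately have "\<exists>p. path p \<and> (\<forall>p'. path p' \<longrightarrow> length p' \<le> length p)"
    by (rule Lattices_Big.ex_has_greatest_nat)
  then obtain p where p: "path p" and max: "\<And>p'. path p' \<Longrightarrow> length p' \<le> length p" by blast
  define x where "x = p ! 0"
  have len: "length p > 0" and dist: "distinct p"
    and ed: "\<And>i. Suc i < length p \<Longrightarrow> {p ! i, p ! Suc i} \<in> edges G"
    using p by (auto simp: path_def)
  have x: "x \<in> verts G" using p len by (auto simp: path_def x_def)
  have nb: "y \<in> set p" if y: "{x, y} \<in> edges G" for y
  proof (rule ccontr)
    assume n: "y \<notin> set p"
    have "{(y # p) ! i, (y # p) ! Suc i} \<in> edges G" if "Suc i < length (y # p)" for i
    proof (cases i)
      case 0
      then show ?thesis using y by (simp add: x_def insert_commute)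
    next
      case (Suc j)
      then show ?thesis using ed[of j] that by simp
    qed
    moreover have "y \<in> verts G" using simple_graph_edgeD[OF s y] by simp
    ultimately have "path (y # p)" using p n unfolding path_def by auto
    from max[OF this] show False by simp
  qed
  have nb1: "y = p ! 1" if y: "{x, y} \<in> edges G" for y
  proof -
    obtain i where i: "i < length p" "p ! i = y" using nb[OF y] by (auto simp: in_set_conv_nth)
    have "i \<noteq> 0"
    proof
      assume "i = 0"
      then show False using simple_graph_edgeD(3)[OF s y] i by (simp add: x_def)
    qed
    moreover have "\<not> i \<ge> 2"
    proof
      assume i2: "i \<ge> 2"
      have "graph_cycle G (take (Suc i) p)"
        unfolding graph_cycle_def
      proof (intro conjI allI impI)
        show "3 \<le> length (take (Suc i) p)" using i i2 by simp
        show "distinct (take (Suc i) p)" using dist by simp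
        fix j assume "j < length (take (Suc i) p)"
        then have j: "j \<le> i" using i by simp
        show "{take (Suc i) p ! j, take (Suc i) p ! (Suc j mod length (take (Suc i) p))} \<in> edges G"
        proof (cases "j = i")
          case True
          then show ?thesis using y i by (simp add: x_def insert_commute)
        next
          case False
          then show ?thesis using ed[of j] j i by simp
        qed
      qed
      with acyc show False by blast
    qed
    ultimately have "i = 1" by simp
    then show ?thesis using i by simp
  qed
  obtain y where "{x, y} \<in> edges G" using connected_graph_has_neighbour[OF con x c] ..
  with nb1 have "neighbours G x = {y}" unfolding neighbours_def by blast
  then show ?thesis using x by (auto simp: leaves_def)
qed

text \<open>An isomorphism invariant that, unlike the sum of the degrees, reveals the degree of the
  vertex to which a leaf was attached.\<close>

definition sum_squared_degrees :: "ugraph \<Rightarrow> nat" where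
  "sum_squared_degrees G = (\<Sum>x\<in>verts G. (card (neighbours G x))\<^sup>2)"

lemma sum_squared_degrees_iso:
  assumes G: "simple_graph G" and H: "simple_graph H" and iso: "graph_iso G H"
  shows "sum_squared_degrees G = sum_squared_degrees H"
proof -
  obtain f where bf: "bij_betw f (verts G) (verts H)"
    and e: "\<And>u v. u \<in> verts G \<Longrightarrow> v \<in> verts G \<Longrightarrow> {u, v} \<in> edges G \<longleftrightarrow> {f u, f v} \<in> edges H"
    using iso unfolding graph_iso_def by blast
  have "card (neighbours H (f x)) = card (neighbours G x)" if x: "x \<in> verts G" for x
  proof -
    have sub: "neighbours G x \<subseteq> verts G" using simple_graph_edgeD[OF G] by (auto simp: neighbours_def)
    have "neighbours H (f x) = f ` neighbours G x"
    proof (intro equalityI subsetI)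
      fix y assume y: "y \<in> neighbours H (f x)"
      then have "y \<in> verts H" using simple_graph_edgeD[OF H] by (auto simp: neighbours_def)
      then obtain z where "z \<in> verts G" "y = f z" using bf by (auto simp: bij_betw_def)
      then show "y \<in> f ` neighbours G x" using y e[OF x] by (auto simp: neighbours_def)
    qed (use e[OF x] sub in \<open>auto simp: neighbours_def\<close>)
    moreover have "inj_on f (neighbours G x)" using bf sub by (meson bij_betw_def inj_on_subset)
    ultimately show ?thesis by (simp add: card_image)
  qed
  then show ?thesis unfolding sum_squared_degrees_def
    by (subst sum.reindex_bij_betw[OF bf, symmetric]) simp
qed

text \<open>The degree \<open>d\<close> of \<open>v\<close> grows by one and a vertex of degree
  \<open>1\<close> appears: \<open>(d + 1)\<^sup>2 - d\<^sup>2 + 1 = 2 * d + 2\<close>.\<close>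

lemma sum_squared_degrees_attach:
  assumes G: "simple_graph G" and v: "v \<in> verts G"
  shows "sum_squared_degrees (attach G v) = sum_squared_degrees G + 2 * card (neighbours G v) + 2"
proof -
  interpret leaf_extension G "attach G v" "fresh G" v using leaf_extension_attach[OF G v] .
  let ?w = "fresh G" and ?V = "verts G"
  have sub: "neighbours G x \<subseteq> ?V" for x using edge_vertices by (auto simp: neighbours_def)
  have "neighbours (attach G v) ?w = {v}"
    using edge_vertices v w by (auto simp: neighbours_def edge_extension_iff simp del: edges_attach)
  moreover have "neighbours (attach G v) v = insert ?w (neighbours G v)"
    using v w by (auto simp: neighbours_def edge_extension_iff simp del: edges_attach)
  then have "card (neighbours (attach G v) v) = Suc (card (neighbours G v))"
    using sub w finite_verts by (metis card_insert_disjoint finite_subset subsetD)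
  moreover have "neighbours (attach G v) x = neighbours G x" if "x \<in> ?V - {v}" for x
    using that w by (auto simp: neighbours_def edge_extension_iff simp del: edges_attach)
  ultimately show ?thesis
    using finite_verts v w sum.remove[OF finite_verts v, of "\<lambda>x. (card (neighbours G x))\<^sup>2"]
      sum.remove[OF finite_verts v, of "\<lambda>x. (card (neighbours (attach G v) x))\<^sup>2"]
    by (simp add: sum_squared_degrees_def power2_eq_square)
qed

text \<open>Otherwise \<open>{l, p}\<close> is closed under adjacency and therefore contains all
  vertices.\<close>

lemma leaf_neighbour_not_leaf:
  assumes G: "simple_graph G" "connected_graph G" and l: "neighbours G l = {p}" and c: "card (verts G) \<ge> 3"
  shows "neighbours G p \<noteq> {l}"
proof
  assume p: "neighbours G p = {l}"
  have "{l, p} \<in> edges G" using l by (auto simp: neighbours_def)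
  then have lV: "l \<in> verts G" using simple_graph_edgeD[OF G(1)] by blast
  have nb: "b = p" if "{l, b} \<in> edges G" for b using l that by (auto simp: neighbours_def)
  have nb': "b = l" if "{p, b} \<in> edges G" for b using p that by (auto simp: neighbours_def)
  have "x \<in> {l, p}" if "x \<in> verts G" for x
    by (rule connected_graph_induct[OF G(2) lV that]) (use nb nb' in auto)
  then have "card (verts G) \<le> card {l, p}" by (intro card_mono) auto
  also have "\<dots> \<le> 2" by (simp add: card_insert_if)
  finally show False using c by simp
qed

text \<open>If all attachments were copies of \<open>T\<close>, all degrees in \<open>G\<close>
  would be equal, hence \<open>1\<close> because of a leaf. On two vertices the claim fails: both
  attachments give the path on three vertices.\<close>

lemma ex_non_isomorphic_attach:
  assumes G: "is_tree G" and c: "card (verts G) \<ge> 3" and T: "is_tree T"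
  shows "\<exists>v\<in>verts G. \<not> graph_iso (attach G v) T"
proof (rule ccontr)
  assume n: "\<not> ?thesis"
  have s: "simple_graph G" and con: "connected_graph G" using G by (auto simp: is_tree_def)
  have "sum_squared_degrees G + 2 * card (neighbours G v) + 2 = sum_squared_degrees T"
    if v: "v \<in> verts G" for v
    using sum_squared_degrees_attach[OF s v] sum_squared_degrees_iso[of "attach G v" T] n v T
      is_tree_attach[OF G v] by (simp add: is_tree_def)
  then have eq: "card (neighbours G u) = card (neighbours G v)" if "u \<in> verts G" "v \<in> verts G" for u v
    using that by (metis add_right_cancel add_left_cancel mult_cancel1 zero_neq_numeral)
  obtain l p where l: "l \<in> verts G" "neighbours G l = {p}"
    using tree_has_leaf[OF G] c by (auto simp: leaves_def)
  have lp: "{l, p} \<in> edges G" using l by (auto simp: neighbours_def)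
  then have p: "p \<in> verts G" using simple_graph_edgeD[OF s] by blast
  have "card (neighbours G p) = 1" using eq[OF p l(1)] l(2) by simp
  moreover have "l \<in> neighbours G p" using lp by (simp add: neighbours_def insert_commute)
  ultimately have "neighbours G p = {l}" by (auto simp: card_1_singleton_iff)
  then show False using leaf_neighbour_not_leaf[OF s con l(2) c] by simp
qed

section \<open>Expectations under uniform attachment\<close>

text \<open>Finite support makes every real function integrable and turns expectations into finite
  sums.\<close>

lemma finite_set_UA_labeled:
  assumes "is_tree S" "card (verts S) \<le> n"
  shows "finite (set_pmf (UA_labeled n S))"
  using assms(2)
proof (induction n rule: dec_induct)
  case base
  then show ?case by (simp add: UA_labeled_seed)
next
  case (step n)
  have "finite (set_pmf (UA_step G))" if "G \<in> set_pmf (UA_labeled n S)" for G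
  proof -
    have "is_tree G" using UA_labeled_tree[OF assms(1) step.hyps(1) that] ..
    then show ?thesis by (subst set_pmf_UA_step) (auto simp: is_tree_def simple_graph_def)
  qed
  then show ?case using step by auto
qed

text \<open>The labels of the seed persist, so a root chosen in \<open>S\<close> stays available in
  all later trees.\<close>

lemma UA_labeled_verts:
  assumes "card (verts S) \<le> n" "G \<in> set_pmf (UA_labeled n S)" "is_tree S"
  shows "verts S \<subseteq> verts G"
  using assms(1,2)
proof (induction n arbitrary: G rule: dec_induct)
  case base
  then show ?case by (simp add: UA_labeled_seed)
next
  case (step n)
  then obtain H where H: "H \<in> set_pmf (UA_labeled n S)" "G \<in> set_pmf (UA_step H)" by auto
  then have "is_tree H" using UA_labeled_tree[OF assms(3) step.hyps(1)] by simp
  then show ?case using H(2) step.IH[OF H(1)] by (auto simp: set_pmf_UA_step)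
qed

abbreviation UA_expectation :: "nat \<Rightarrow> ugraph \<Rightarrow> (ugraph \<Rightarrow> real) \<Rightarrow> real" where
  "UA_expectation n S f \<equiv> measure_pmf.expectation (UA_labeled n S) f"

lemma UA_expectation_cong:
  assumes "is_tree S" "card (verts S) \<le> n"
    and "\<And>G. is_tree G \<Longrightarrow> card (verts G) = n \<Longrightarrow> f G = g G"
  shows "UA_expectation n S f = UA_expectation n S g"
  by (rule Bochner_Integration.integral_cong_AE)
    (use assms(3) UA_labeled_tree[OF assms(1,2)] in \<open>auto simp: AE_measure_pmf_iff\<close>)

lemma UA_expectation_mono:
  assumes "is_tree S" "card (verts S) \<le> n"
    and "\<And>G. G \<in> set_pmf (UA_labeled n S) \<Longrightarrow> f G \<le> g G"
  shows "UA_expectation n S f \<le> UA_expectation n S g"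
  by (rule integral_mono_AE)
    (use assms(3) integrable_measure_pmf_finite[OF finite_set_UA_labeled[OF assms(1,2)]]
      in \<open>auto simp: AE_measure_pmf_iff\<close>)

lemma UA_expectation_Suc:
  assumes S: "is_tree S" and n: "card (verts S) \<le> n"
  shows "UA_expectation (Suc n) S f =
    UA_expectation n S (\<lambda>G. (\<Sum>v\<in>verts G. f (attach G v)) / real n)"
proof -
  let ?A = "set_pmf (UA_labeled n S)"
  have fin: "finite ?A" using finite_set_UA_labeled[OF S n] .
  have tree: "is_tree G" "card (verts G) = n" "finite (verts G)" "verts G \<noteq> {}" if "G \<in> ?A" for G
    using UA_labeled_tree[OF S n that] by (auto simp: is_tree_def simple_graph_def connected_graph_def)
  have step: "measure_pmf.expectation (UA_step G) f = (\<Sum>v\<in>verts G. f (attach G v)) / real n"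
    if "G \<in> ?A" for G
    using tree[OF that] by (simp add: UA_step_def integral_pmf_of_set)
  have "UA_expectation (Suc n) S f = measure_pmf.expectation (UA_labeled n S \<bind> UA_step) f"
    using n by simp
  also have "\<dots> = (\<Sum>G\<in>?A. pmf (UA_labeled n S) G *\<^sub>R measure_pmf.expectation (UA_step G) f)"
    by (rule pmf_expectation_bind[OF fin]) (use tree in \<open>auto simp: set_pmf_UA_step\<close>)
  also have "\<dots> = (\<Sum>G\<in>?A. pmf (UA_labeled n S) G *\<^sub>R ((\<Sum>v\<in>verts G. f (attach G v)) / real n))"
    using step by (intro sum.cong) auto
  also have "\<dots> = UA_expectation n S (\<lambda>G. (\<Sum>v\<in>verts G. f (attach G v)) / real n)"
    by (rule integral_measure_pmf[OF fin, symmetric]) auto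
  finally show ?thesis .
qed

lemma UA_expectation_pattern_count_Suc:
  assumes S: "is_tree S" "card (verts S) \<le> n"
    and P: "simple_graph P" "connected_graph P" "card (verts P) \<ge> 2"
  shows "UA_expectation (Suc n) S (pattern_count P) =
    ((real n + 2 * real (card (verts P))) * UA_expectation n S (pattern_count P) +
     2 * (\<Sum>u\<in>leaves P. UA_expectation n S (pattern_count (delete u P)))) / real n"
proof -
  have int: "integrable (UA_labeled n S) f" for f :: "ugraph \<Rightarrow> real"
    by (rule integrable_measure_pmf_finite[OF finite_set_UA_labeled[OF S]])
  have "UA_expectation (Suc n) S (pattern_count P) =
      UA_expectation n S (\<lambda>G. ((real n + 2 * real (card (verts P))) * pattern_count P G +
        2 * (\<Sum>u\<in>leaves P. pattern_count (delete u P) G)) / real n)"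
    unfolding UA_expectation_Suc[OF S]
    by (rule UA_expectation_cong[OF S]) (simp add: sum_pattern_count_attach P is_tree_def)
  then show ?thesis by (simp add: int Bochner_Integration.integral_sum)
qed

text \<open>The factors \<open>(j + 2) / j\<close> from \<open>sum_potential_attach\<close>
  telescope, for \<open>j\<close> from \<open>k = card (verts S)\<close> to \<open>n - 1\<close>, to
  \<open>n * (n + 1) / (k * (k + 1))\<close>.\<close>

lemma UA_expectation_potential:
  assumes S: "is_tree S" "card (verts S) \<le> n" and r: "r \<in> verts S"
  shows "UA_expectation n S (\<lambda>G. potential G r) * (real (card (verts S)) * (real (card (verts S)) + 1)) =
    potential S r * (real n * (real n + 1))"
  using S(2)
proof (induction n rule: dec_induct)
  case base
  then show ?case by (simp add: UA_labeled_seed)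
next
  case (step n)
  have k: "card (verts S) > 0" using r S(1) by (auto simp: is_tree_def simple_graph_def card_gt_0_iff)
  have n: "n > 0" using k step.hyps by simp
  have "UA_expectation (Suc n) S (\<lambda>G. potential G r) =
      UA_expectation n S (\<lambda>G. (\<Sum>v\<in>verts G. potential (attach G v) r) / real n)"
    by (rule UA_expectation_Suc[OF S(1) step.hyps(1)])
  also have "\<dots> = UA_expectation n S (\<lambda>G. (real n + 2) * potential G r / real n)"
  proof (rule Bochner_Integration.integral_cong_AE)
    show "AE G in UA_labeled n S. (\<Sum>v\<in>verts G. potential (attach G v) r) / real n =
        (real n + 2) * potential G r / real n"
      unfolding AE_measure_pmf_iff
    proof
      fix G assume G: "G \<in> set_pmf (UA_labeled n S)"
      have t: "simple_graph G" "connected_graph G" "card (verts G) = n"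
        using UA_labeled_tree[OF S(1) step.hyps(1) G] by (auto simp: is_tree_def)
      have "r \<in> verts G" using UA_labeled_verts[OF step.hyps(1) G S(1)] r by blast
      with t show "(\<Sum>v\<in>verts G. potential (attach G v) r) / real n = (real n + 2) * potential G r / real n"
        by (simp add: sum_potential_attach)
    qed
  qed auto
  also have "\<dots> = (real n + 2) / real n * UA_expectation n S (\<lambda>G. potential G r)" by simp
  finally have "UA_expectation (Suc n) S (\<lambda>G. potential G r) *
      (real (card (verts S)) * (real (card (verts S)) + 1)) =
      (real n + 2) / real n * (potential S r * (real n * (real n + 1)))"
    by (simp only: mult.assoc step.IH)
  also have "\<dots> = potential S r * (real (Suc n) * (real (Suc n) + 1))"
    using n by (simp add: field_simps)
  finally show ?case .
qed

section \<open>Separation of the seeds\<close>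

text \<open>Values of \<open>h\<close> far above the scale \<open>s\<close> contribute little to
  either mean because of the second moments, so a gap of order \<open>s\<close> must come from a
  difference of the laws. The bound \<open>\<bar>h\<bar> \<le> h\<^sup>2 / K + K\<close> is a smooth
  truncation at level \<open>K\<close>.\<close>

lemma TV_ge:
  fixes h :: "'a \<Rightarrow> real"
  assumes X: "finite X" "set_pmf p \<subseteq> X" "set_pmf q \<subseteq> X" and pos: "B > 0" "c > 0" "s > 0"
    and p: "measure_pmf.expectation p (\<lambda>x. (h x)\<^sup>2) \<le> B * s\<^sup>2"
    and q: "measure_pmf.expectation q (\<lambda>x. (h x)\<^sup>2) \<le> B * s\<^sup>2"
    and sep: "c * s \<le> \<bar>measure_pmf.expectation p h - measure_pmf.expectation q h\<bar>"
  shows "c\<^sup>2 / (16 * B) \<le> TV X p q"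
proof -
  define d where "d x = \<bar>pmf p x - pmf q x\<bar>" for x
  \<comment> \<open>With this level the second-moment term \<open>2 * B * s\<^sup>2 / K\<close> uses
    up exactly half of the gap \<open>c * s\<close>.\<close>
  define K where "K = 4 * B * s / c"
  have K: "K > 0" using pos by (simp add: K_def)
  have E: "measure_pmf.expectation p f = (\<Sum>x\<in>X. f x * pmf p x)"
    "measure_pmf.expectation q f = (\<Sum>x\<in>X. f x * pmf q x)" for f :: "'a \<Rightarrow> real"
    using X by (auto intro!: integral_measure_pmf_real)
  have "c * s \<le> \<bar>\<Sum>x\<in>X. h x * (pmf p x - pmf q x)\<bar>"
    using sep by (simp add: E sum_subtractf right_diff_distrib)
  also have "\<dots> \<le> (\<Sum>x\<in>X. \<bar>h x\<bar> * d x)"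
    using sum_abs[of "\<lambda>x. h x * (pmf p x - pmf q x)" X] by (simp add: d_def abs_mult)
  also have "\<dots> \<le> (\<Sum>x\<in>X. ((h x)\<^sup>2 / K + K) * d x)"
  proof (intro sum_mono mult_right_mono)
    fix x
    have "0 \<le> (\<bar>h x\<bar> - K)\<^sup>2" by simp
    then have "2 * K * \<bar>h x\<bar> \<le> (h x)\<^sup>2 + K\<^sup>2" by (simp add: power2_diff mult_ac)
    moreover have "K * \<bar>h x\<bar> \<ge> 0" using K by simp
    ultimately have "K * \<bar>h x\<bar> \<le> (h x)\<^sup>2 + K\<^sup>2" by linarith
    then show "\<bar>h x\<bar> \<le> (h x)\<^sup>2 / K + K" using K by (simp add: field_simps power2_eq_square)
  qed (simp add: d_def)
  also have "\<dots> = (\<Sum>x\<in>X. (h x)\<^sup>2 * d x) / K + K * (\<Sum>x\<in>X. d x)"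
    by (simp add: distrib_right sum.distrib sum_divide_distrib sum_distrib_left)
  also have "(\<Sum>x\<in>X. (h x)\<^sup>2 * d x) \<le> (\<Sum>x\<in>X. (h x)\<^sup>2 * (pmf p x + pmf q x))"
    by (intro sum_mono mult_left_mono) (auto simp: d_def abs_le_iff)
  also have "\<dots> \<le> 2 * B * s\<^sup>2" using p q by (simp add: E distrib_left sum.distrib)
  also have "(\<Sum>x\<in>X. d x) = 2 * TV X p q" by (simp add: TV_def d_def)
  finally have "c * s \<le> 2 * B * s\<^sup>2 / K + K * (2 * TV X p q)"
    using K by (simp add: divide_right_mono)
  also have "2 * B * s\<^sup>2 / K = c * s / 2" using pos by (simp add: K_def power2_eq_square field_simps)
  finally have "s * (c / 2) \<le> K * (2 * TV X p q)" by (simp add: mult.commute)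
  also have "\<dots> = s * (8 * B * TV X p q / c)" by (simp add: K_def)
  finally have "c / 2 \<le> 8 * B * TV X p q / c"
    by (rule mult_left_le_imp_le) (rule pos(3))
  then show ?thesis using pos by (simp add: field_simps power2_eq_square)
qed

lemma power_le_pochhammer:
  fixes x :: real
  assumes "x \<ge> 0"
  shows "x ^ k \<le> pochhammer x k"
proof (induction k)
  case (Suc k)
  have "x * x ^ k \<le> (x + real k) * pochhammer x k"
    using assms Suc by (intro mult_mono) auto
  then show ?case by (simp add: pochhammer_rec')
qed simp

text \<open>Both sides are \<open>pochhammer x (Suc k)\<close>, with the first or the last factor
  split off.\<close>

lemma pochhammer_shift:
  fixes x :: real
  shows "x * pochhammer (x + 1) k = (x + real k) * pochhammer x k"
  using pochhammer_rec[of x k] pochhammer_rec'[of x k] by simp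

text \<open>Rooted at a vertex \<open>r\<close> of the seed, the expected potential is at most
  \<open>2 * potential S r\<close> times \<open>n\<^sup>2\<close>, which cancels the normalisation
  in \<open>pattern_count_squared_le\<close>.\<close>

lemma UA_second_moment:
  assumes S: "is_tree S"
    and P: "simple_graph P" "connected_graph P" "card (verts P) \<ge> 2"
  shows "\<exists>B\<ge>0. \<forall>n\<ge>card (verts S).
    UA_expectation n S (\<lambda>G. (pattern_count P G)\<^sup>2) \<le> B * (real n ^ (2 * card (verts P)))\<^sup>2"
proof -
  define k where "k = real (card (verts S))"
  define m where "m = card (verts P)"
  obtain r where r: "r \<in> verts S" using S by (auto simp: is_tree_def connected_graph_def)
  have k: "k \<ge> 1" using r S by (auto simp: k_def is_tree_def simple_graph_def Suc_le_eq card_gt_0_iff)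
  obtain C where C: "C \<ge> 0" "\<And>G r. simple_graph G \<Longrightarrow> connected_graph G \<Longrightarrow> r \<in> verts G \<Longrightarrow>
      (pattern_count P G)\<^sup>2 \<le> C * real (card (verts G)) ^ (4 * m) * (potential G r / (real (card (verts G)))\<^sup>2)"
    using pattern_count_squared_le[OF P] unfolding m_def by blast
  define B where "B = C * (2 * potential S r)"
  have "UA_expectation n S (\<lambda>G. (pattern_count P G)\<^sup>2) \<le> B * (real n ^ (2 * m))\<^sup>2"
    if n: "card (verts S) \<le> n" for n
  proof -
    have n1: "real n \<ge> 1" using k n by (simp add: k_def)
    have "UA_expectation n S (\<lambda>G. (pattern_count P G)\<^sup>2) \<le>
        UA_expectation n S (\<lambda>G. C * real n ^ (4 * m) * (potential G r / (real n)\<^sup>2))"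
    proof (rule UA_expectation_mono[OF S n])
      fix G assume G: "G \<in> set_pmf (UA_labeled n S)"
      have t: "simple_graph G" "connected_graph G" "card (verts G) = n"
        using UA_labeled_tree[OF S n G] by (auto simp: is_tree_def)
      have "r \<in> verts G" using UA_labeled_verts[OF n G S] r by blast
      then show "(pattern_count P G)\<^sup>2 \<le> C * real n ^ (4 * m) * (potential G r / (real n)\<^sup>2)"
        using C(2)[OF t(1,2)] t(3) by simp
    qed
    also have "\<dots> = C * real n ^ (4 * m) * (UA_expectation n S (\<lambda>G. potential G r) / (real n)\<^sup>2)"
      by simp
    also have "\<dots> \<le> C * real n ^ (4 * m) * (2 * potential S r)"
    proof (intro mult_left_mono)
      have E: "UA_expectation n S (\<lambda>G. potential G r) \<ge> 0"
        by (intro Bochner_Integration.integral_nonneg potential_nonneg)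
      have "1 * 1 \<le> k * (k + 1)" using k by (intro mult_mono) auto
      then have "UA_expectation n S (\<lambda>G. potential G r) \<le> UA_expectation n S (\<lambda>G. potential G r) * (k * (k + 1))"
        using mult_left_mono[OF _ E] by fastforce
      also have "\<dots> = potential S r * (real n * (real n + 1))"
        using UA_expectation_potential[OF S n r] by (simp add: k_def)
      also have "\<dots> \<le> potential S r * (real n * (real n + real n))"
        using n1 by (intro mult_left_mono potential_nonneg) auto
      finally show "UA_expectation n S (\<lambda>G. potential G r) / (real n)\<^sup>2 \<le> 2 * potential S r"
        using n1 by (simp add: field_simps power2_eq_square)
    qed (use C(1) in simp)
    also have "real n ^ (4 * m) = (real n ^ (2 * m))\<^sup>2" by (simp flip: power_mult)
    finally show ?thesis by (simp add: B_def mult_ac)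
  qed
  moreover have "B \<ge> 0" using C(1) potential_nonneg by (simp add: B_def)
  ultimately show ?thesis unfolding m_def by blast
qed

text \<open>\<open>TV\<close> compares laws on isomorphism classes, so the test function has to live
  there; by \<open>pattern_count_iso\<close> the choice of the representative is immaterial.\<close>

definition class_pattern_count :: "ugraph \<Rightarrow> ugraph set \<Rightarrow> real" where
  "class_pattern_count P c = pattern_count P (SOME G. G \<in> c)"

lemma class_pattern_count_iso_class:
  assumes P: "simple_graph P" and G: "is_tree G"
  shows "class_pattern_count P (iso_class G) = pattern_count P G"
proof -
  have "G \<in> iso_class G" using G graph_iso_refl by (simp add: iso_class_def)
  then have "(SOME H. H \<in> iso_class G) \<in> iso_class G" by (rule someI)
  then have "simple_graph (SOME H. H \<in> iso_class G)" "graph_iso G (SOME H. H \<in> iso_class G)"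
    by (auto simp: iso_class_def is_tree_def)
  then show ?thesis
    using pattern_count_iso[OF P] G unfolding class_pattern_count_def is_tree_def by metis
qed

lemma expectation_UA_class:
  fixes f :: "real \<Rightarrow> real"
  assumes S: "is_tree S" "card (verts S) \<le> n" and P: "simple_graph P"
  shows "measure_pmf.expectation (UA n S) (\<lambda>c. f (class_pattern_count P c)) =
    UA_expectation n S (\<lambda>G. f (pattern_count P G))"
  unfolding UA_def integral_map_pmf
  by (rule UA_expectation_cong[OF S]) (simp add: class_pattern_count_iso_class[OF P])

text \<open>A smallest separating pattern keeps the two means apart at the scale
  \<open>n ^ (2 * m)\<close>, and with \<open>UA_second_moment\<close> and \<open>TV_ge\<close> this
  becomes a lower bound on \<open>TV\<close> that is uniform in \<open>n\<close>.\<close>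

lemma delta_pos_if_separated:
  assumes S: "is_tree S" "card (verts S) \<le> N" and T: "is_tree T" "card (verts T) \<le> N"
    and Q: "simple_graph Q" "connected_graph Q"
      "UA_expectation N S (pattern_count Q) \<noteq> UA_expectation N T (pattern_count Q)"
  shows "delta S T > 0"
proof -
  define d where "d n P = UA_expectation n S (pattern_count P) - UA_expectation n T (pattern_count P)" for n P
  define sep where "sep P \<longleftrightarrow> simple_graph P \<and> connected_graph P \<and> d N P \<noteq> 0" for P
  have "sep Q" using Q by (simp add: sep_def d_def)
  then obtain P where P: "sep P" and min: "\<And>P'. sep P' \<Longrightarrow> card (verts P) \<le> card (verts P')"
    using ex_has_least_nat[of sep Q "\<lambda>P. card (verts P)"] by blast
  have sP: "simple_graph P" and cP: "connected_graph P" and dP: "d N P \<noteq> 0"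
    using P by (auto simp: sep_def)
  define m where "m = card (verts P)"
  have single: "d n P' = 0" if h: "simple_graph P'" "card (verts P') = 1" "n \<ge> N" for n P'
  proof -
    obtain u where u: "verts P' = {u}" using h(2) card_1_singletonE by blast
    have "UA_expectation n S (pattern_count P') = real n * (real n * (real n + 1))"
      using UA_expectation_cong[OF S(1), of n "pattern_count P'" "\<lambda>_. real n * (real n * (real n + 1))"]
        S(2) h(3) pattern_count_singleton[OF h(1) u] by (simp add: is_tree_def)
    moreover have "UA_expectation n T (pattern_count P') = real n * (real n * (real n + 1))"
      using UA_expectation_cong[OF T(1), of n "pattern_count P'" "\<lambda>_. real n * (real n * (real n + 1))"]
        T(2) h(3) pattern_count_singleton[OF h(1) u] by (simp add: is_tree_def)
    ultimately show ?thesis by (simp add: d_def)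
  qed
  have card_pos: "card (verts P') > 0" if "simple_graph P'" "connected_graph P'" for P'
    using that by (auto simp: simple_graph_def connected_graph_def card_gt_0_iff)
  have rec: "d (Suc n) P' = ((real n + 2 * real (card (verts P'))) * d n P' +
      2 * (\<Sum>u\<in>leaves P'. d n (delete u P'))) / real n"
    if "simple_graph P'" "connected_graph P'" "card (verts P') \<ge> 2" "n \<ge> N" for n P'
    using UA_expectation_pattern_count_Suc[OF S(1) _ that(1-3), of n]
      UA_expectation_pattern_count_Suc[OF T(1) _ that(1-3), of n] S(2) T(2) that(4)
    by (simp add: d_def sum_subtractf right_diff_distrib add_divide_distrib diff_divide_distrib)
  have smaller: "card (verts (delete u P')) < card (verts P')" "simple_graph (delete u P')"
    "connected_graph (delete u P')"
    if h: "simple_graph P'" "connected_graph P'" "u \<in> leaves P'" for u P'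
  proof -
    obtain p where "neighbours P' u = {p}" "u \<in> verts P'" using h(3) by (auto simp: leaves_def)
    then show "card (verts (delete u P')) < card (verts P')" "simple_graph (delete u P')"
      "connected_graph (delete u P')"
      using h card_pos[OF h(1,2)]
      by (simp_all add: simple_graph_delete connected_graph_delete_leaf)
  qed
  \<comment> \<open>Minimality speaks about size \<open>N\<close> only. The recursion carries the
    vanishing to larger \<open>n\<close>, since deleting a leaf leads to a still smaller connected
    pattern.\<close>
  have vanish: "d n P' = 0" if "simple_graph P'" "connected_graph P'" "card (verts P') < m" "n \<ge> N" for n P'
    using that(4,1-3)
  proof (induction n arbitrary: P' rule: dec_induct)
    case base
    then show ?case using min[of P'] by (force simp: sep_def m_def)
  next
    case (step n)
    show ?case
    proof (cases "card (verts P') \<ge> 2")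
      case True
      have "d n (delete u P') = 0" if "u \<in> leaves P'" for u
        using smaller[OF step.prems(1,2) that] step.IH[of "delete u P'"] step.prems(3) by simp
      then show ?thesis using rec[OF step.prems(1,2) True step.hyps(1)] step.IH[OF step.prems] by simp
    next
      case False
      then have "card (verts P') = 1" using card_pos[OF step.prems(1,2)] by simp
      then show ?thesis using single[OF step.prems(1)] step.hyps by simp
    qed
  qed
  have m2: "m \<ge> 2"
  proof (rule ccontr)
    assume "\<not> m \<ge> 2"
    then have "card (verts P) = 1" using card_pos[OF sP cP] by (simp add: m_def)
    with single[OF sP, of N] dP show False by simp
  qed
  have N: "N > 0" using card_pos[of S] S by (auto simp: is_tree_def)
  \<comment> \<open>The lower-order terms are gone, and the remaining recursion with factor
    \<open>(n + 2 * m) / n\<close> is solved by the rising factorial of \<open>n\<close> of length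
    \<open>2 * m\<close>.\<close>
  have growth: "d n P * pochhammer (real N) (2 * m) = d N P * pochhammer (real n) (2 * m)" if "n \<ge> N" for n
    using that
  proof (induction n rule: dec_induct)
    case (step n)
    have n: "real n > 0" using N step.hyps by simp
    have "d n (delete u P) = 0" if "u \<in> leaves P" for u
      using smaller[OF sP cP that] step.hyps by (intro vanish) (auto simp: m_def)
    then have "d (Suc n) P = (real n + 2 * real m) * d n P / real n"
      using rec[OF sP cP, of n] m2 step.hyps by (simp add: m_def)
    then have "d (Suc n) P * pochhammer (real N) (2 * m) =
        (real n + 2 * real m) * (d N P * pochhammer (real n) (2 * m)) / real n"
      using step.IH by simp
    also have "\<dots> = d N P * ((real n + real (2 * m)) * pochhammer (real n) (2 * m)) / real n" by simp
    also have "\<dots> = d N P * pochhammer (real (Suc n)) (2 * m)"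
      using n unfolding pochhammer_shift[symmetric] by (simp add: add.commute)
    finally show ?case .
  qed simp
  define K where "K = pochhammer (real N) (2 * m)"
  have K: "K > 0" using N by (simp add: K_def pochhammer_pos)
  define c where "c = \<bar>d N P\<bar> / K"
  have c: "c > 0" using K dP by (simp add: c_def)
  have lower: "c * real n ^ (2 * m) \<le> \<bar>d n P\<bar>" if "n \<ge> N" for n
  proof -
    have "d n P * K = d N P * pochhammer (real n) (2 * m)" using growth[OF that] by (simp add: K_def)
    then have "\<bar>d n P\<bar> * K = \<bar>d N P\<bar> * pochhammer (real n) (2 * m)"
      using K pochhammer_nonneg[of "real n" "2 * m"] N that
      by (metis abs_mult abs_of_nonneg less_imp_le of_nat_0_less_iff order_less_le_trans)
    then have "\<bar>d n P\<bar> = c * pochhammer (real n) (2 * m)" using K by (simp add: c_def field_simps)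
    then show ?thesis using power_le_pochhammer[of "real n" "2 * m"] c by simp
  qed
  obtain B1 where B1: "B1 \<ge> 0" "\<And>n. n \<ge> card (verts S) \<Longrightarrow>
      UA_expectation n S (\<lambda>G. (pattern_count P G)\<^sup>2) \<le> B1 * (real n ^ (2 * m))\<^sup>2"
    using UA_second_moment[OF S(1) sP cP] m2 unfolding m_def by blast
  obtain B2 where B2: "B2 \<ge> 0" "\<And>n. n \<ge> card (verts T) \<Longrightarrow>
      UA_expectation n T (\<lambda>G. (pattern_count P G)\<^sup>2) \<le> B2 * (real n ^ (2 * m))\<^sup>2"
    using UA_second_moment[OF T(1) sP cP] m2 unfolding m_def by blast
  \<comment> \<open>One constant for both seeds; the summand \<open>1\<close> makes it positive, as
    \<open>TV_ge\<close> requires.\<close>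
  define B where "B = B1 + B2 + 1"
  have B: "B > 0" using B1(1) B2(1) by (simp add: B_def)
  have "c\<^sup>2 / (16 * B) \<le> TV (tree_classes n) (UA n S) (UA n T)" if n: "n \<ge> N" for n
  proof (rule TV_ge[where s = "real n ^ (2 * m)" and h = "class_pattern_count P"])
    have nS: "card (verts S) \<le> n" and nT: "card (verts T) \<le> n" using S T n by auto
    show "set_pmf (UA n S) \<subseteq> tree_classes n" "set_pmf (UA n T) \<subseteq> tree_classes n"
      using set_pmf_UA S T nS nT by blast+
    show "0 < real n ^ (2 * m)" using N n by simp
    show "measure_pmf.expectation (UA n S) (\<lambda>x. (class_pattern_count P x)\<^sup>2) \<le> B * (real n ^ (2 * m))\<^sup>2"
      unfolding expectation_UA_class[OF S(1) nS sP, of "\<lambda>x. x\<^sup>2"]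
      by (rule order_trans[OF B1(2)[OF nS]], rule mult_right_mono) (use B1 B2 in \<open>auto simp: B_def\<close>)
    show "measure_pmf.expectation (UA n T) (\<lambda>x. (class_pattern_count P x)\<^sup>2) \<le> B * (real n ^ (2 * m))\<^sup>2"
      unfolding expectation_UA_class[OF T(1) nT sP, of "\<lambda>x. x\<^sup>2"]
      by (rule order_trans[OF B2(2)[OF nT]], rule mult_right_mono) (use B1 B2 in \<open>auto simp: B_def\<close>)
    show "c * real n ^ (2 * m) \<le> \<bar>measure_pmf.expectation (UA n S) (class_pattern_count P) -
        measure_pmf.expectation (UA n T) (class_pattern_count P)\<bar>"
      using lower[OF n] expectation_UA_class[OF S(1) nS sP, of "\<lambda>x. x"]
        expectation_UA_class[OF T(1) nT sP, of "\<lambda>x. x"] by (simp add: d_def)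
  qed (use B c finite_tree_classes in auto)
  then have "c\<^sup>2 / (16 * B) \<le> delta S T"
    by (intro LIMSEQ_le_const[OF delta_LIMSEQ[OF S(1) T(1)]]) blast
  moreover have "c\<^sup>2 / (16 * B) > 0" using B c by simp
  ultimately show ?thesis by linarith
qed

text \<open>For equal sizes the law is concentrated on \<open>S\<close> itself. Otherwise the last
  step before reaching the size of \<open>T\<close> can be chosen to avoid \<open>T\<close>, by
  \<open>ex_non_isomorphic_attach\<close>.\<close>

lemma ex_UA_labeled_non_isomorphic:
  assumes S: "is_tree S" and T: "is_tree T" and card: "card (verts S) \<le> card (verts T)" "card (verts S) \<ge> 3"
    and ni: "\<not> graph_iso S T"
  shows "\<exists>H\<in>set_pmf (UA_labeled (card (verts T)) S). \<not> graph_iso H T"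
proof (cases "card (verts S) = card (verts T)")
  case True
  then show ?thesis using ni UA_labeled_seed[of S] by simp
next
  case False
  then obtain n where n: "card (verts T) = Suc n" "card (verts S) \<le> n"
    using card by (cases "card (verts T)") auto
  obtain G where G: "G \<in> set_pmf (UA_labeled n S)" using set_pmf_not_empty[of "UA_labeled n S"] by blast
  have t: "is_tree G" "card (verts G) = n" using UA_labeled_tree[OF S n(2) G] by auto
  obtain v where v: "v \<in> verts G" "\<not> graph_iso (attach G v) T"
    using ex_non_isomorphic_attach[OF t(1) _ T] t(2) n(2) card(2) by auto
  have "attach G v \<in> set_pmf (UA_labeled (Suc n) S)"
    using n(2) G v(1) set_pmf_UA_step[OF t(1)] by auto
  then show ?thesis using v(2) n(1) by (metis (lifting))
qed

text \<open>The pattern is a tree \<open>H\<close> into which \<open>S\<close> can grow and which is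
  no copy of \<open>T\<close>: its count vanishes at \<open>T\<close>, whereas \<open>S\<close>
  becomes \<open>H\<close> with positive probability.\<close>

lemma ex_separating_pattern:
  assumes S: "is_tree S" and T: "is_tree T" and card: "card (verts S) \<le> card (verts T)" "card (verts S) \<ge> 3"
    and ni: "\<not> graph_iso S T"
  shows "\<exists>P. simple_graph P \<and> connected_graph P \<and>
    UA_expectation (card (verts T)) S (pattern_count P) \<noteq> UA_expectation (card (verts T)) T (pattern_count P)"
proof -
  let ?N = "card (verts T)"
  obtain H where H: "H \<in> set_pmf (UA_labeled ?N S)" "\<not> graph_iso H T"
    using ex_UA_labeled_non_isomorphic[OF assms] by blast
  have t: "simple_graph H" "connected_graph H" "card (verts H) = ?N"
    using UA_labeled_tree[OF S card(1) H(1)] by (auto simp: is_tree_def)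
  have fin: "finite (set_pmf (UA_labeled ?N S))" using finite_set_UA_labeled[OF S card(1)] .
  have "UA_expectation ?N T (pattern_count H) = 0"
    using pattern_count_eq_0[of T H] T t H(2) by (simp add: UA_labeled_seed is_tree_def)
  moreover have "UA_expectation ?N S (pattern_count H) =
      (\<Sum>G\<in>set_pmf (UA_labeled ?N S). pattern_count H G * pmf (UA_labeled ?N S) G)"
    by (rule integral_measure_pmf_real[OF fin]) auto
  moreover have "\<dots> > 0"
  proof (rule sum_pos2[OF fin H(1)])
    show "pattern_count H H * pmf (UA_labeled ?N S) H > 0"
      using pattern_count_self_pos[OF t(1)] H(1) by (simp add: pmf_positive)
  qed (simp add: pattern_count_nonneg)
  ultimately show ?thesis using t by (intro exI[of _ H]) simp
qed

theorem theorem1: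
  fixes S T :: ugraph
  assumes "is_tree S" and "is_tree T"
    and "card (verts S) \<ge> 3" and "card (verts T) \<ge> 3"
    and "\<not> graph_iso S T"
  shows "delta S T > 0"
proof (cases "card (verts S) \<le> card (verts T)")
  case True
  then show ?thesis
    using ex_separating_pattern[OF assms(1,2) True assms(3,5)] delta_pos_if_separated[OF assms(1) True assms(2)]
    by blast
next
  case False
  then have le: "card (verts T) \<le> card (verts S)" by simp
  \<comment> \<open>The search for the pattern takes the smaller seed first;
    \<open>delta_pos_if_separated\<close> treats the seeds alike, so no symmetry of
    \<open>delta\<close> enters.\<close>
  have "\<not> graph_iso T S" using assms(5) graph_iso_sym by blast
  from ex_separating_pattern[OF assms(2,1) le assms(4) this] show ?thesis
    using delta_pos_if_separated[OF assms(1) _ assms(2) le] by (metis order_refl)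
qed

end
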